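(* Let $(X_k)_{k\ge 0}$ be a Markov chain with transition kernel $P$ on a measurable space $(E,\mathcal{E})$, and let $\mathcal{E}^0\subseteq\mathcal{E}$ be a sub-$\sigma$-field. The following are equivalent. 1. (Local ergodicity) $\|\mathbf{P}^\mu-\mathbf{P}^\nu\|_{\mathcal{F}^0_{n,\infty}}\to 0$ as $n\to\infty$ for every $\mu,\nu\in\mathcal{P}(E)$. 2. (Triviality of the local tail $\sigma$-field) $\mathbf{P}^\mu(A)\in\{0,1\}$ for every $A\in\mathcal{A}^0$ and $\mu\in\mathcal{P}(E)$. 3. (Local irreducibility) There exists $\alpha>0$ such that for all $x,x'\in E$ there exists $n\ge 0$ such that $\|\mathbf{P}^x-\mathbf{P}^{x'}\|_{\mathcal{F}^0_{n,\infty}}\le 2-\alpha$.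
   Context: $(E,\mathcal{E})$ is a measurable space, $\Omega=E^{\mathbb{Z}}$, $\mathcal{F}=\mathcal{E}^{\mathbb{Z}}$ (product $\sigma$-field), $X_k(\omega)=\omega(k)$ is the coordinate process, and $\mathcal{F}_+=\sigma\{X_k:k\ge 0\}$. $P:E\times\mathcal{E}\to[0,1]$ is a transition kernel, $\mathcal{P}(E)$ is the set of probability measures on $(E,\mathcal{E})$, and for $\mu\in\mathcal{P}(E)$, $\mathbf{P}^\mu$ is the probability measure on $\mathcal{F}_+$ under which $(X_k)_{k\ge 0}$ is Markov with transition kernel $P$ and initial law $X_0\sim\mu$; $\mathbf{P}^x=\mathbf{P}^{\delta_x}$ for $x\in E$. Given the sub-$\sigma$-field $\mathcal{E}^0\subseteq\mathcal{E}$, define $\mathcal{F}^0_{m,n}=\bigvee_{m\le k\le n}X_k^{-1}(\mathcal{E}^0)$ for $m<n$ (with $n=\infty$ allowed, in which case $k$ ranges over all $m\le k<\infty$), and the local tail $\sigma$-field $\mathcal{A}^0=\bigcap_{n\ge 0}\mathcal{F}^0_{n,\infty}$. For probability measures $\mu,\nu$ and a $\sigma$-field $\mathcal{G}$, $\|\mu-\nu\|_{\mathcal{G}}=2\sup_{A\in\mathcal{G}}|\mu(A)-\nu(A)|$. *)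

theory Defs
  imports "HOL-Probability.Probability"
begin

(* The sigma-field on the path space E^Z generated by the maps X_k^{-1}(G), k in I, as a measure
   space whose measure is irrelevant.  For a sub-sigma-field G of E the underlying space, taken
   from G, is the path space of E, since G and E have the same underlying space. *)
definition path_field :: "'a measure \<Rightarrow> int set \<Rightarrow> (int \<Rightarrow> 'a) measure" where
  "path_field G I =
    (let \<Omega> = space (\<Pi>\<^sub>M k\<in>(UNIV :: int set). G)
     in sigma \<Omega> (\<Union>k\<in>I. {(\<lambda>\<omega>. \<omega> k) -` A \<inter> \<Omega> | A. A \<in> sets G}))"

definition path_tail :: "'a measure \<Rightarrow> (int \<Rightarrow> 'a) set set" where
  "path_tail G = (\<Inter>n::nat. sets (path_field G {int n..}))"

(* Q lives on F_+ = sigma(X_k : k >= 0), although the paths are indexed by all integers. *)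
definition is_chain_law ::
  "'a measure \<Rightarrow> ('a \<Rightarrow> 'a measure) \<Rightarrow> 'a measure \<Rightarrow> (int \<Rightarrow> 'a) measure \<Rightarrow> bool" where
  "is_chain_law E P \<mu> Q \<longleftrightarrow>
    prob_space Q \<and> sets Q = sets (path_field E {0..}) \<and>
    distr Q E (\<lambda>\<omega>. \<omega> 0) = \<mu> \<and>
    (\<forall>k\<ge>0. \<forall>A\<in>sets E. AE \<omega> in Q.
       real_cond_exp Q (path_field E {0..k}) (indicator ((\<lambda>\<omega>. \<omega> (k + 1)) -` A \<inter> space Q)) \<omega>
         = measure (P (\<omega> k)) A)"

(* Existence and uniqueness are shown in is_chain_law_chain_law and is_chain_law_unique. *)
definition chain_law ::
  "'a measure \<Rightarrow> ('a \<Rightarrow> 'a measure) \<Rightarrow> 'a measure \<Rightarrow> (int \<Rightarrow> 'a) measure" where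
  "chain_law E P \<mu> = (THE Q. is_chain_law E P \<mu> Q)"

definition tv_dist :: "'b measure \<Rightarrow> 'b measure \<Rightarrow> 'b measure \<Rightarrow> real" where
  "tv_dist G M N = 2 * (SUP A\<in>sets G. \<bar>measure M A - measure N A\<bar>)"

lemma space_path_field: "space (path_field G I) = space (\<Pi>\<^sub>M k\<in>(UNIV :: int set). G)"
  by (auto simp: path_field_def Let_def intro!: space_measure_of)

lemma sets_path_field: "sets (path_field G I) = sigma_sets (space (\<Pi>\<^sub>M k\<in>(UNIV :: int set). G))
    (\<Union>k\<in>I. {(\<lambda>\<omega>. \<omega> k) -` A \<inter> space (\<Pi>\<^sub>M k\<in>(UNIV :: int set). G) | A. A \<in> sets G})"
  by (auto simp: path_field_def Let_def intro!: sets_measure_of)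

lemma component_path_field: "k \<in> I \<Longrightarrow> (\<lambda>\<omega>. \<omega> k) \<in> path_field G I \<rightarrow>\<^sub>M G"
  by (rule measurableI) (auto simp: space_path_field sets_path_field space_PiM)

lemma measurable_path_fieldI:
  assumes "\<And>x. x \<in> space M \<Longrightarrow> f x \<in> space (\<Pi>\<^sub>M k\<in>(UNIV :: int set). G)"
    and "\<And>k. k \<in> I \<Longrightarrow> (\<lambda>x. f x k) \<in> M \<rightarrow>\<^sub>M G"
  shows "f \<in> M \<rightarrow>\<^sub>M path_field G I"
proof (rule measurable_sigma_sets[OF sets_path_field])
  show "f \<in> space M \<rightarrow> space (\<Pi>\<^sub>M k\<in>(UNIV :: int set). G)" using assms(1) by auto
  fix y assume "y \<in> (\<Union>k\<in>I. {(\<lambda>\<omega>. \<omega> k) -` A \<inter> space (\<Pi>\<^sub>M k\<in>(UNIV :: int set). G) | A. A \<in> sets G})"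
  then obtain k A where k: "k \<in> I" "A \<in> sets G"
    and y: "y = (\<lambda>\<omega>. \<omega> k) -` A \<inter> space (\<Pi>\<^sub>M k\<in>(UNIV :: int set). G)" by auto
  have "f -` y \<inter> space M = (\<lambda>x. f x k) -` A \<inter> space M" using assms(1) y by auto
  then show "f -` y \<inter> space M \<in> sets M" using measurable_sets[OF assms(2)] k by simp
qed auto

lemma sets_path_field_mono: "I \<subseteq> J \<Longrightarrow> sets (path_field G I) \<subseteq> sets (path_field G J)"
  unfolding sets_path_field by (rule sigma_sets_mono') auto

lemma is_chain_law_iff:
  assumes P: "P \<in> E \<rightarrow>\<^sub>M prob_algebra E" and Q: "prob_space Q"
    and sQ: "sets Q = sets (path_field E {0..})"
    and k: "k \<ge> 0" and A: "A \<in> sets E"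
  shows "(AE \<omega> in Q.
       real_cond_exp Q (path_field E {0..k}) (indicator ((\<lambda>\<omega>. \<omega> (k + 1)) -` A \<inter> space Q)) \<omega>
         = measure (P (\<omega> k)) A) \<longleftrightarrow>
     (\<forall>B\<in>sets (path_field E {0..k}). emeasure Q (B \<inter> (\<lambda>\<omega>. \<omega> (k + 1)) -` A)
         = (\<integral>\<^sup>+\<omega>. emeasure (P (\<omega> k)) A * indicator B \<omega> \<partial>Q))" (is "?L \<longleftrightarrow> ?R")
proof -
  interpret prob_space Q by fact
  let ?F = "path_field E {0..k}" and ?C = "(\<lambda>\<omega>. \<omega> (k + 1)) -` A \<inter> space Q"
  have spQ: "space Q = space (path_field E {0..})" using sQ by (rule sets_eq_imp_space_eq)
  have sub: "subalgebra Q ?F"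
    unfolding subalgebra_def sQ spQ using sets_path_field_mono[of "{0..k}" "{0..}" E]
    by (auto simp: space_path_field)
  interpret S: sigma_finite_subalgebra Q ?F
    using sub by (simp add: finite_measure_axioms finite_measure_subalgebra_axioms.intro
      finite_measure_subalgebra.intro finite_measure_subalgebra_is_sigma_finite)
  have P': "P \<in> E \<rightarrow>\<^sub>M subprob_algebra E" using P by (rule measurable_prob_algebraD)
  have mP: "(\<lambda>\<omega>. measure (P (\<omega> k)) A) \<in> borel_measurable ?F"
    using A k by (intro measurable_compose[OF measurable_compose[OF component_path_field P'] measurable_measure_subprob_algebra]) auto
  then have mPQ: "(\<lambda>\<omega>. measure (P (\<omega> k)) A) \<in> borel_measurable Q"
    using sub by (rule measurable_from_subalg[rotated])
  have pP: "prob_space (P (\<omega> k))" if "\<omega> \<in> space Q" for \<omega>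
  proof -
    have "\<omega> k \<in> space E" using that k measurable_space[OF component_path_field[of k "{0..}" E]] spQ by auto
    then show ?thesis using P by (auto dest: measurable_space simp: space_prob_algebra)
  qed
  have le1: "measure (P (\<omega> k)) A \<le> 1" if "\<omega> \<in> space Q" for \<omega>
    using pP[OF that] by (rule prob_space.prob_le_1)
  have iP: "integrable Q (\<lambda>\<omega>. measure (P (\<omega> k)) A)"
    using mPQ le1 by (intro integrable_const_bound[where B=1]) auto
  have C: "?C \<in> sets Q"
    unfolding sQ spQ using k A by (intro measurable_sets[OF component_path_field]) auto
  have iC: "integrable Q (indicator ?C :: _ \<Rightarrow> real)"
    using C by (intro integrable_real_indicator) (auto simp: emeasure_eq_measure)
  have BQ: "B \<in> sets Q" if "B \<in> sets ?F" for B using that sub by (auto simp: subalgebra_def)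
  have eqC: "ennreal (\<integral>\<omega>\<in>B. indicator ?C \<omega> \<partial>Q) = emeasure Q (B \<inter> (\<lambda>\<omega>. \<omega> (k + 1)) -` A)"
    if "B \<in> sets ?F" for B
  proof -
    have "(\<integral>\<omega>\<in>B. indicator ?C \<omega> \<partial>Q) = (\<integral>\<omega>. indicat_real (B \<inter> (\<lambda>\<omega>. \<omega> (k + 1)) -` A) \<omega> \<partial>Q)"
      unfolding set_lebesgue_integral_def using sets.sets_into_space[OF BQ[OF that]]
      by (intro Bochner_Integration.integral_cong) (auto simp: indicator_def)
    moreover have "B \<inter> (\<lambda>\<omega>. \<omega> (k + 1)) -` A = B \<inter> ?C" using sets.sets_into_space[OF BQ[OF that]] by auto
    moreover have "(\<integral>\<omega>. indicat_real (B \<inter> ?C) \<omega> \<partial>Q) = measure Q (B \<inter> ?C)"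
      using sets.Int[OF BQ[OF that] C] by (simp add: Int_absorb2 sets.sets_into_space)
    ultimately show ?thesis by (simp only: emeasure_eq_measure)
  qed
  have eqP: "ennreal (\<integral>\<omega>\<in>B. measure (P (\<omega> k)) A \<partial>Q) = (\<integral>\<^sup>+\<omega>. emeasure (P (\<omega> k)) A * indicator B \<omega> \<partial>Q)"
    if "B \<in> sets ?F" for B
  proof -
    have "(\<integral>\<^sup>+\<omega>. emeasure (P (\<omega> k)) A * indicator B \<omega> \<partial>Q)
        = (\<integral>\<^sup>+\<omega>. ennreal (indicator B \<omega> *\<^sub>R measure (P (\<omega> k)) A) \<partial>Q)"
      using pP by (intro nn_integral_cong)
        (auto simp: indicator_def finite_measure.emeasure_eq_measure prob_space.finite_measure)
    also have "\<dots> = ennreal (\<integral>\<omega>\<in>B. measure (P (\<omega> k)) A \<partial>Q)"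
      unfolding set_lebesgue_integral_def using iP BQ[OF that]
      by (intro nn_integral_eq_integral integrable_mult_indicator) (auto simp: indicator_def)
    finally show ?thesis by simp
  qed
  have nn: "0 \<le> (\<integral>\<omega>\<in>B. measure (P (\<omega> k)) A \<partial>Q)" "0 \<le> (\<integral>\<omega>\<in>B. indicator ?C \<omega> \<partial>Q :: real)" for B
    unfolding set_lebesgue_integral_def by (auto intro!: integral_nonneg simp: indicator_def)
  show ?thesis
  proof
    assume L: ?L
    show ?R
    proof
      fix B assume B: "B \<in> sets ?F"
      have "(\<integral>\<omega>\<in>B. indicator ?C \<omega> \<partial>Q) = (\<integral>\<omega>\<in>B. real_cond_exp Q ?F (indicator ?C) \<omega> \<partial>Q)"
        by (rule S.real_cond_exp_intA[OF iC B])
      also have "\<dots> = (\<integral>\<omega>\<in>B. measure (P (\<omega> k)) A \<partial>Q)"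
        unfolding set_lebesgue_integral_def using L BQ[OF B] mPQ by (intro integral_cong_AE) auto
      finally show "emeasure Q (B \<inter> (\<lambda>\<omega>. \<omega> (k + 1)) -` A)
         = (\<integral>\<^sup>+\<omega>. emeasure (P (\<omega> k)) A * indicator B \<omega> \<partial>Q)"
        using eqC[OF B] eqP[OF B] by simp
    qed
  next
    assume R: ?R
    show ?L
    proof (rule S.real_cond_exp_charact[OF _ iC iP mP])
      fix B assume B: "B \<in> sets ?F"
      show "(\<integral>\<omega>\<in>B. indicator ?C \<omega> \<partial>Q) = (\<integral>\<omega>\<in>B. measure (P (\<omega> k)) A \<partial>Q)"
        by (subst ennreal_inj[OF nn(2) nn(1), symmetric]) (simp only: eqC[OF B] eqP[OF B] bspec[OF R B])
    qed
  qed
qed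

lemma path_field_cong_on:
  assumes "B \<in> sets (path_field G I)" "\<And>k. k \<in> I \<Longrightarrow> \<omega> k = \<omega>' k"
    and "\<omega> \<in> space (path_field G I)" "\<omega>' \<in> space (path_field G I)"
  shows "\<omega> \<in> B \<longleftrightarrow> \<omega>' \<in> B"
  using assms(1) unfolding sets_path_field
proof induction
  case (Basic a)
  then show ?case using assms(2-) by (auto simp: space_path_field)
next
  case (Compl a)
  then show ?case using assms(3,4) by (auto simp: space_path_field)
qed auto

lemma path_field_eqI:
  assumes Q: "prob_space Q" and R: "prob_space R"
    and sQ: "sets Q = sets (path_field E {0..})" and sR: "sets R = sets (path_field E {0..})"
    and I: "I \<subseteq> {0..}" and G: "Int_stable G" "G \<subseteq> Pow (space (path_field E I))"
    and gen: "sets (path_field E I) = sigma_sets (space (path_field E I)) G"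
    and sp: "space (path_field E I) \<in> G"
    and eq: "\<And>X. X \<in> G \<Longrightarrow> emeasure Q X = emeasure R X"
    and B: "B \<in> sets (path_field E I)"
  shows "emeasure Q B = emeasure R B"
proof -
  interpret Q: prob_space Q by fact
  interpret R: prob_space R by fact
  have sub: "subalgebra Q (path_field E I)" "subalgebra R (path_field E I)"
    using sets_path_field_mono[OF I, of E] sQ sR sets_eq_imp_space_eq[OF sQ] sets_eq_imp_space_eq[OF sR]
    by (auto simp: subalgebra_def space_path_field)
  have GF: "X \<in> sets (path_field E I)" if "X \<in> G" for X unfolding gen using that by auto
  have "restr_to_subalg Q (path_field E I) = restr_to_subalg R (path_field E I)"
  proof (rule measure_eqI_generator_eq[OF G])
    show "emeasure (restr_to_subalg Q (path_field E I)) X = emeasure (restr_to_subalg R (path_field E I)) X"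
      if "X \<in> G" for X
      using that eq[OF that] GF[OF that] sub by (simp add: emeasure_restr_to_subalg)
    show "range (\<lambda>_::nat. space (path_field E I)) \<subseteq> G" using sp by auto
    show "emeasure (restr_to_subalg Q (path_field E I)) (space (path_field E I)) \<noteq> \<infinity>"
      using sub by (simp add: emeasure_restr_to_subalg)
  qed (use sub gen in \<open>auto simp: sets_restr_to_subalg\<close>)
  then show ?thesis using B sub by (metis emeasure_restr_to_subalg)
qed

lemma is_chain_law_unique:
  assumes P: "P \<in> E \<rightarrow>\<^sub>M prob_algebra E"
    and Q: "is_chain_law E P \<mu> Q" and R: "is_chain_law E P \<mu> R"
  shows "Q = R"
proof -
  have pQ: "prob_space Q" and pR: "prob_space R"
    and sQ: "sets Q = sets (path_field E {0..})" and sR: "sets R = sets (path_field E {0..})"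
    and dQ: "distr Q E (\<lambda>\<omega>. \<omega> 0) = \<mu>" and dR: "distr R E (\<lambda>\<omega>. \<omega> 0) = \<mu>"
    using Q R by (auto simp: is_chain_law_def)
  let ?\<Omega> = "space (\<Pi>\<^sub>M k\<in>(UNIV :: int set). E)"
  have spQ: "space Q = ?\<Omega>" and spR: "space R = ?\<Omega>"
    using sQ sR by (auto dest!: sets_eq_imp_space_eq simp: space_path_field)
  have mQ: "(\<lambda>\<omega>. \<omega> 0) \<in> Q \<rightarrow>\<^sub>M E" and mR: "(\<lambda>\<omega>. \<omega> 0) \<in> R \<rightarrow>\<^sub>M E"
    using component_path_field[of 0 "{0..}" E] by (auto simp: measurable_cong_sets[OF sQ refl] measurable_cong_sets[OF sR refl])
  have subF: "sets (path_field E {0..int k}) \<subseteq> sets (path_field E {0..})" for k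
    by (rule sets_path_field_mono) auto
  have eqk: "emeasure Q B = emeasure R B" if "B \<in> sets (path_field E {0..int k})" for k B
    using that
  proof (induction k arbitrary: B)
    case 0
    have "B \<in> sets (vimage_algebra ?\<Omega> (\<lambda>\<omega>. \<omega> 0) E)"
      using 0 by (simp add: sets_path_field sets_vimage_algebra)
    then obtain A where A: "A \<in> sets E" "B = (\<lambda>\<omega>. \<omega> 0) -` A \<inter> ?\<Omega>"
      by (subst (asm) sets_vimage_algebra2) (auto simp: space_PiM)
    then show ?case
      using emeasure_distr[OF mQ, of A] emeasure_distr[OF mR, of A] by (simp add: dQ dR spQ spR)
  next
    case (Suc k)
    let ?F = "path_field E {0..int k}"
    let ?X = "\<lambda>A. (\<lambda>\<omega>. \<omega> (int k + 1)) -` A"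
    define G where "G = {B \<inter> ?X A | A B. A \<in> sets E \<and> B \<in> sets ?F}"
    have GI: "B \<inter> ?X A \<in> G" if "A \<in> sets E" "B \<in> sets ?F" for A B using that by (auto simp: G_def)
    have \<Omega>X: "\<omega> i \<in> space E" if "\<omega> \<in> ?\<Omega>" for \<omega> i using that by (auto simp: space_PiM)
    have sub1: "sets ?F \<subseteq> sets (path_field E {0..int (Suc k)})"
      by (rule sets_path_field_mono) auto
    have intoF: "B \<subseteq> ?\<Omega>" if "B \<in> sets ?F" for B
      using sets.sets_into_space[OF that] by (simp add: space_path_field)
    have \<Omega>F: "?\<Omega> \<in> sets ?F" using sets.top[of ?F] by (simp add: space_path_field)
    have Gsub: "G \<subseteq> sets (path_field E {0..int (Suc k)})"
    proof
      fix Z assume "Z \<in> G"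
      then obtain A B where Z: "A \<in> sets E" "B \<in> sets ?F" "Z = B \<inter> ?X A" by (auto simp: G_def)
      have "Z = B \<inter> (?X A \<inter> space (path_field E {0..int (Suc k)}))"
        using intoF Z by (auto simp: space_path_field)
      also have "\<dots> \<in> sets (path_field E {0..int (Suc k)})"
        using Z sub1 by (intro sets.Int measurable_sets[OF component_path_field]) auto
      finally show "Z \<in> sets (path_field E {0..int (Suc k)})" .
    qed
    have gen: "sets (path_field E {0..int (Suc k)}) = sigma_sets ?\<Omega> G"
    proof
      show "sigma_sets ?\<Omega> G \<subseteq> sets (path_field E {0..int (Suc k)})"
        using Gsub sets.sigma_sets_subset[of G "path_field E {0..int (Suc k)}"] by (simp add: space_path_field)
      show "sets (path_field E {0..int (Suc k)}) \<subseteq> sigma_sets ?\<Omega> G"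
        unfolding sets_path_field[of E "{0..int (Suc k)}"]
      proof (rule sigma_sets_mono', safe)
        fix i A assume i: "i \<in> {0..int (Suc k)}" and A: "A \<in> sets E"
        show "(\<lambda>\<omega>. \<omega> i) -` A \<inter> ?\<Omega> \<in> G"
        proof (cases "i = int k + 1")
          case True
          then show ?thesis using GI[OF A \<Omega>F] by (simp add: Int_commute)
        next
          case False
          then have "(\<lambda>\<omega>. \<omega> i) -` A \<inter> space ?F \<in> sets ?F"
            using i A by (intro measurable_sets[OF component_path_field]) auto
          from GI[OF sets.top this]
          have "(\<lambda>\<omega>. \<omega> i) -` A \<inter> ?\<Omega> \<inter> ?X (space E) \<in> G" by (simp add: space_path_field)
          moreover have "(\<lambda>\<omega>. \<omega> i) -` A \<inter> ?\<Omega> \<inter> ?X (space E) = (\<lambda>\<omega>. \<omega> i) -` A \<inter> ?\<Omega>" using \<Omega>X by auto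
          ultimately show ?thesis by simp
        qed
      qed
    qed
    show ?case
    proof (rule path_field_eqI[OF pQ pR sQ sR _ _ _ _ _ _ Suc.prems, where G=G])
      show "Int_stable G"
      proof (rule Int_stableI)
        fix a b assume "a \<in> G" "b \<in> G"
        then obtain A B A' B' where
          "A \<in> sets E" "B \<in> sets ?F" "a = B \<inter> ?X A" "A' \<in> sets E" "B' \<in> sets ?F" "b = B' \<inter> ?X A'"
          by (auto simp: G_def)
        then show "a \<inter> b \<in> G" using GI[of "A \<inter> A'" "B \<inter> B'"] by (auto simp: ac_simps Int_def vimage_def)
      qed
      show "G \<subseteq> Pow (space (path_field E {0..int (Suc k)}))"
        using Gsub sets.space_closed by blast
      show "space (path_field E {0..int (Suc k)}) \<in> G"
      proof -
        have "?\<Omega> \<inter> ?X (space E) = ?\<Omega>" using \<Omega>X by auto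
        then show ?thesis using GI[OF sets.top \<Omega>F] by (simp add: space_path_field)
      qed
      fix Z assume "Z \<in> G"
      then obtain A B where Z: "A \<in> sets E" "B \<in> sets ?F" "Z = B \<inter> ?X A" by (auto simp: G_def)
      have subQ: "subalgebra Q ?F" "subalgebra R ?F"
        using subF[of k] sQ sR spQ spR by (auto simp: subalgebra_def space_path_field)
      have eqr: "restr_to_subalg Q ?F = restr_to_subalg R ?F"
        using Suc.IH subQ by (intro measure_eqI) (auto simp: sets_restr_to_subalg emeasure_restr_to_subalg)
      have m: "(\<lambda>\<omega>. emeasure (P (\<omega> (int k))) A * indicator B \<omega>) \<in> borel_measurable ?F"
        using Z by (intro borel_measurable_times_ennreal borel_measurable_indicator measurable_compose[OF
          measurable_compose[OF component_path_field measurable_prob_algebraD[OF P]] measurable_emeasure_subprob_algebra]) auto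
      have "emeasure Q Z = (\<integral>\<^sup>+\<omega>. emeasure (P (\<omega> (int k))) A * indicator B \<omega> \<partial>Q)"
        using Q Z is_chain_law_iff[OF P pQ sQ, of "int k" A] by (auto simp: is_chain_law_def)
      also have "\<dots> = (\<integral>\<^sup>+\<omega>. emeasure (P (\<omega> (int k))) A * indicator B \<omega> \<partial>R)"
        using nn_integral_subalgebra2[OF subQ(1) m] nn_integral_subalgebra2[OF subQ(2) m] eqr by simp
      also have "\<dots> = emeasure R Z"
        using R Z is_chain_law_iff[OF P pR sR, of "int k" A] by (auto simp: is_chain_law_def)
      finally show "emeasure Q Z = emeasure R Z" .
    qed (use gen in \<open>auto simp: space_path_field\<close>)
  qed
  define G where "G = (\<Union>k. sets (path_field E {0..int k}))"
  show ?thesis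
  proof (rule measure_eqI)
    fix B assume "B \<in> sets Q"
    then have B: "B \<in> sets (path_field E {0..})" by (simp add: sQ)
    show "emeasure Q B = emeasure R B"
    proof (rule path_field_eqI[OF pQ pR sQ sR _ _ _ _ _ _ B, where G=G])
      show "Int_stable G"
      proof (rule Int_stableI)
        fix a b assume "a \<in> G" "b \<in> G"
        then obtain i j where "a \<in> sets (path_field E {0..int i})" "b \<in> sets (path_field E {0..int j})"
          by (auto simp: G_def)
        then have "a \<in> sets (path_field E {0..int (max i j)})" "b \<in> sets (path_field E {0..int (max i j)})"
          using sets_path_field_mono[of "{0..int i}" "{0..int (max i j)}" E]
            sets_path_field_mono[of "{0..int j}" "{0..int (max i j)}" E] by auto
        then show "a \<inter> b \<in> G" unfolding G_def by blast
      qed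
      have Gsub: "G \<subseteq> sets (path_field E {0..})" using subF by (auto simp: G_def)
      then show "G \<subseteq> Pow (space (path_field E {0..}))" using sets.space_closed by blast
      show "space (path_field E {0..}) \<in> G"
        using sets.top[of "path_field E {0..int 0}"] unfolding G_def space_path_field by blast
      show "sets (path_field E {0..}) = sigma_sets (space (path_field E {0..})) G"
      proof
        show "sigma_sets (space (path_field E {0..})) G \<subseteq> sets (path_field E {0..})"
          using Gsub by (rule sets.sigma_sets_subset)
        show "sets (path_field E {0..}) \<subseteq> sigma_sets (space (path_field E {0..})) G"
          unfolding sets_path_field[of E "{0..}"] space_path_field
        proof (rule sigma_sets_mono', safe)
          fix i :: int and A assume i: "0 \<le> i" and A: "A \<in> sets E"
          have "(\<lambda>\<omega>. \<omega> i) -` A \<inter> space (path_field E {0..int (nat i)}) \<in> sets (path_field E {0..int (nat i)})"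
            using i A by (intro measurable_sets[OF component_path_field]) auto
          then show "(\<lambda>\<omega>. \<omega> i) -` A \<inter> ?\<Omega> \<in> G" unfolding G_def space_path_field by blast
        qed
      qed
      show "emeasure Q X = emeasure R X" if "X \<in> G" for X using that eqk by (auto simp: G_def)
    qed auto
  qed (simp add: sQ sR)
qed

lemma is_chain_law_exists:
  assumes P: "P \<in> E \<rightarrow>\<^sub>M prob_algebra E" and \<mu>: "\<mu> \<in> space (prob_algebra E)"
  shows "\<exists>Q. is_chain_law E P \<mu> Q"
proof -
  define PP where "PP n = (case n of 0 \<Rightarrow> (\<lambda>_. \<mu>) | Suc m \<Rightarrow> (\<lambda>\<omega>. P (\<omega> m)))" for n :: nat
  have P': "P \<in> E \<rightarrow>\<^sub>M subprob_algebra E" using P by (rule measurable_prob_algebraD)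
  interpret \<mu>: prob_space \<mu> using \<mu> by (simp add: space_prob_algebra)
  have s\<mu>: "sets \<mu> = sets E" using \<mu> by (simp add: space_prob_algebra)
  interpret IT: Ionescu_Tulcea PP "\<lambda>_. E"
  proof (rule Ionescu_Tulcea.intro)
    show "PP i \<in> Pi\<^sub>M {0..<i} (\<lambda>_. E) \<rightarrow>\<^sub>M subprob_algebra E" for i
    proof (cases i)
      case 0
      have "\<mu> \<in> space (subprob_algebra E)"
        using s\<mu> by (simp add: space_subprob_algebra \<mu>.subprob_space_axioms)
      then show ?thesis by (simp add: PP_def 0)
    next
      case (Suc m)
      then show ?thesis
        by (auto simp: PP_def intro!: measurable_compose[OF measurable_component_singleton[of m] P'])
    qed
    show "prob_space (PP i x)" if "x \<in> space (Pi\<^sub>M {0..<i} (\<lambda>_. E))" for i x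
    proof (cases i)
      case 0
      then show ?thesis by (simp add: PP_def \<mu>.prob_space_axioms)
    next
      case (Suc m)
      then have "x m \<in> space E" using that by (auto simp: space_PiM)
      then show ?thesis using measurable_space[OF P] by (simp add: PP_def Suc space_prob_algebra)
    qed
  qed
  let ?M = "\<lambda>J. Pi\<^sub>M J (\<lambda>_. E) :: (nat \<Rightarrow> 'a) measure"
  define D where "D n = IT.C 0 n (\<lambda>x. undefined)" for n
  define L where "L = IT.PF.lim"
  have sL: "sets L = sets (?M UNIV)" by (simp add: L_def)
  have spL: "space L = space (?M UNIV)" using sL by (rule sets_eq_imp_space_eq)
  have u: "(\<lambda>x. undefined) \<in> space (?M {0..<0})" by (simp add: space_PiM)
  have sD: "sets (D n) = sets (?M {0..<n})" for n using IT.sets_C[OF u] by (simp add: D_def)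
  have spD: "space (D n) = space (?M {0..<n})" for n using sD by (rule sets_eq_imp_space_eq)
  have rL: "(\<lambda>x. restrict x {0..<n}) \<in> L \<rightarrow>\<^sub>M ?M {0..<n}" for n
    unfolding measurable_cong_sets[OF sL refl] by (rule measurable_restrict_subset) auto
  have dL: "distr L (?M {0..<n}) (\<lambda>x. restrict x {0..<n}) = D n" for n
  proof -
    have "distr L (?M {0..<n}) (\<lambda>x. restrict x {0..<n}) = IT.CI {0..<n}"
      unfolding L_def by (rule IT.distr_lim) auto
    also have "\<dots> = D n"
    proof (rule measure_eqI)
      fix A assume "A \<in> sets (IT.CI {0..<n})"
      then have A: "A \<in> sets (?M {0..<n})" by (simp add: IT.CI_def)
      show "emeasure (IT.CI {0..<n}) A = emeasure (D n) A"
        using IT.emeasure_CI[OF subset_refl A] A sets.sets_into_space[OF A]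
        by (simp add: D_def prod_emb_id space_PiM)
    qed (simp add: IT.CI_def sD)
    finally show ?thesis .
  qed
  have pL: "prob_space L"
    using IT.prob_space_C[OF u, of 0] dL[of 0] prob_space_distrD[OF rL[of 0]] by (simp add: D_def)
  define \<phi> where "\<phi> \<omega> i = \<omega> (nat i)" for \<omega> :: "nat \<Rightarrow> 'a" and i :: int
  have mL: "(\<lambda>\<omega>. \<omega> n) \<in> L \<rightarrow>\<^sub>M E" for n
    unfolding measurable_cong_sets[OF sL refl] by (rule measurable_component_singleton) auto
  have m\<phi>: "\<phi> \<in> L \<rightarrow>\<^sub>M path_field E {0..}"
    by (rule measurable_path_fieldI) (auto simp: \<phi>_def spL space_PiM intro: mL)
  define Q where "Q = distr L (path_field E {0..}) \<phi>"
  have sQ: "sets Q = sets (path_field E {0..})" by (simp add: Q_def)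
  have pQ: "prob_space Q" unfolding Q_def by (rule prob_space.prob_space_distr[OF pL m\<phi>])
  have init: "distr Q E (\<lambda>\<omega>. \<omega> 0) = \<mu>"
  proof -
    have "distr Q E (\<lambda>\<omega>. \<omega> 0) = distr L E (\<lambda>\<omega>. \<omega> 0)"
      unfolding Q_def by (subst distr_distr) (auto simp: component_path_field m\<phi> comp_def \<phi>_def)
    also have "\<dots> = distr (D 1) E (\<lambda>\<omega>. \<omega> 0)"
      unfolding dL[symmetric]
      by (subst distr_distr[OF _ rL]) (auto simp: comp_def intro!: distr_cong measurable_component_singleton)
    also have "D 1 = IT.eP 0 (\<lambda>x. undefined)"
      using bind_return[OF IT.measurable_eP[of 0] u] by (simp add: D_def)
    also have "distr (IT.eP 0 (\<lambda>x. undefined)) E (\<lambda>\<omega>. \<omega> 0) = distr \<mu> E (\<lambda>x. x)"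
      unfolding IT.eP_def PP_def nat.case
    proof (subst distr_distr)
      show "fun_upd (\<lambda>x. undefined) 0 \<in> \<mu> \<rightarrow>\<^sub>M Pi\<^sub>M {0..<Suc 0} (\<lambda>_. E)"
        using u by (intro measurable_fun_upd[where J="{0..<0}"]) (auto simp: measurable_cong_sets[OF s\<mu> refl])
      show "(\<lambda>\<omega>. \<omega> 0) \<in> Pi\<^sub>M {0..<Suc 0} (\<lambda>_. E) \<rightarrow>\<^sub>M E" by (rule measurable_component_singleton) simp
    qed (simp add: comp_def)
    also have "\<dots> = \<mu>" using s\<mu> by (rule distr_id2[OF sym])
    finally show ?thesis .
  qed
  have markov: "emeasure Q (B \<inter> (\<lambda>\<omega>. \<omega> (int k + 1)) -` A)
      = (\<integral>\<^sup>+\<omega>. emeasure (P (\<omega> (int k))) A * indicator B \<omega> \<partial>Q)"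
    if A: "A \<in> sets E" and B: "B \<in> sets (path_field E {0..int k})" for k A B
  proof -
    define n where "n = Suc k"
    define \<psi> where "\<psi> \<omega> i = \<omega> (min (nat i) k)" for \<omega> :: "nat \<Rightarrow> 'a" and i :: int
    have m\<psi>: "\<psi> \<in> ?M {0..<n} \<rightarrow>\<^sub>M path_field E {0..int k}"
      by (rule measurable_path_fieldI)
        (auto simp: \<psi>_def space_PiM n_def PiE_iff intro!: measurable_component_singleton)
    define B' where "B' = \<psi> -` B \<inter> space (?M {0..<n})"
    have B': "B' \<in> sets (?M {0..<n})" unfolding B'_def using measurable_sets[OF m\<psi> B] .
    have \<phi>\<psi>: "\<phi> \<omega> \<in> B \<longleftrightarrow> restrict \<omega> {0..<n} \<in> B'" if "\<omega> \<in> space L" for \<omega>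
    proof -
      have r: "restrict \<omega> {0..<n} \<in> space (?M {0..<n})" using measurable_space[OF rL that] .
      have "\<phi> \<omega> \<in> B \<longleftrightarrow> \<psi> (restrict \<omega> {0..<n}) \<in> B"
        using measurable_space[OF m\<psi> r] measurable_space[OF m\<phi> that]
        by (intro path_field_cong_on[OF B]) (auto simp: \<phi>_def \<psi>_def n_def space_path_field min_def)
      then show ?thesis using r by (simp add: B'_def)
    qed
    have BA: "B \<inter> (\<lambda>\<omega>. \<omega> (int k + 1)) -` A \<in> sets (path_field E {0..})"
    proof -
      have "B \<inter> (\<lambda>\<omega>. \<omega> (int k + 1)) -` A = B \<inter> ((\<lambda>\<omega>. \<omega> (int k + 1)) -` A \<inter> space (path_field E {0..}))"
        using sets.sets_into_space[OF B] by (auto simp: space_path_field)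
      also have "\<dots> \<in> sets (path_field E {0..})"
        using B sets_path_field_mono[of "{0..int k}" "{0..}" E] A
        by (intro sets.Int measurable_sets[OF component_path_field]) auto
      finally show ?thesis .
    qed
    define Z where "Z = {\<omega> \<in> space (?M {0..<Suc n}). restrict \<omega> {0..<n} \<in> B' \<and> \<omega> n \<in> A}"
    have Z: "Z \<in> sets (?M {0..<Suc n})"
    proof -
      have "Z = ((\<lambda>\<omega>. restrict \<omega> {0..<n}) -` B' \<inter> space (?M {0..<Suc n}))
          \<inter> ((\<lambda>\<omega>. \<omega> n) -` A \<inter> space (?M {0..<Suc n}))" by (auto simp: Z_def)
      also have "\<dots> \<in> sets (?M {0..<Suc n})"
        using A B' by (intro sets.Int measurable_sets[OF measurable_restrict_subset]
          measurable_sets[OF measurable_component_singleton]) auto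
      finally show ?thesis .
    qed
    have mPk: "(\<lambda>\<omega>. emeasure (P (\<omega> k)) A * indicator B' \<omega>) \<in> borel_measurable (?M {0..<n})"
      using A B' by (intro borel_measurable_times_ennreal borel_measurable_indicator measurable_compose[OF
          measurable_compose[OF measurable_component_singleton[of k] P'] measurable_emeasure_subprob_algebra]) (auto simp: n_def)
    have mPQ: "(\<lambda>\<omega>. emeasure (P (\<omega> (int k))) A * indicator B \<omega>) \<in> borel_measurable (path_field E {0..})"
      using A B sets_path_field_mono[of "{0..int k}" "{0..}" E]
      by (intro borel_measurable_times_ennreal borel_measurable_indicator measurable_compose[OF
          measurable_compose[OF component_path_field P'] measurable_emeasure_subprob_algebra]) auto
    have "emeasure Q (B \<inter> (\<lambda>\<omega>. \<omega> (int k + 1)) -` A)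
        = emeasure L (\<phi> -` (B \<inter> (\<lambda>\<omega>. \<omega> (int k + 1)) -` A) \<inter> space L)"
      unfolding Q_def by (rule emeasure_distr[OF m\<phi> BA])
    also have "\<phi> -` (B \<inter> (\<lambda>\<omega>. \<omega> (int k + 1)) -` A) \<inter> space L
        = (\<lambda>x. restrict x {0..<Suc n}) -` Z \<inter> space L"
      using \<phi>\<psi> measurable_space[OF rL, of _ "Suc n"]
      by (auto simp: Z_def \<phi>_def n_def nat_add_distrib Int_absorb2 restrict_restrict simp del: restrict_apply)
        (auto simp: restrict_restrict Int_absorb1)
    also have "emeasure L \<dots> = emeasure (D (Suc n)) Z"
      unfolding dL[symmetric] using Z by (rule emeasure_distr[OF rL, symmetric])
    also have "\<dots> = (\<integral>\<^sup>+\<omega>. emeasure (IT.eP n \<omega>) Z \<partial>D n)"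
    proof -
      have "D (Suc n) = D n \<bind> IT.eP n" by (simp add: D_def)
      moreover have "space (D n) \<noteq> {}"
        unfolding D_def using IT.prob_space_C[OF u] by (rule prob_space.not_empty)
      moreover have "IT.eP n \<in> D n \<rightarrow>\<^sub>M subprob_algebra (?M {0..<Suc n})"
        using IT.measurable_eP by (simp add: measurable_cong_sets[OF sD refl])
      ultimately show ?thesis using Z by (simp add: emeasure_bind)
    qed
    also have "\<dots> = (\<integral>\<^sup>+\<omega>. emeasure (P (\<omega> k)) A * indicator B' \<omega> \<partial>D n)"
    proof (rule nn_integral_cong)
      fix \<omega> assume "\<omega> \<in> space (D n)"
      then have w: "\<omega> \<in> space (?M {0..<n})" by (simp add: spD)
      have "restrict (fun_upd \<omega> n x) {0..<n} = \<omega>" for x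
        using w by (auto simp: space_PiM PiE_iff extensional_def restrict_def)
      moreover have "fun_upd \<omega> n x \<in> space (?M {0..<Suc n})" if "x \<in> space E" for x
        using w that by (auto simp: space_PiM PiE_iff extensional_def)
      ultimately have "(\<lambda>x. fun_upd \<omega> n x) -` Z \<inter> space E = (if \<omega> \<in> B' then A else {})"
        using sets.sets_into_space[OF A] by (auto simp: Z_def)
      then show "emeasure (IT.eP n \<omega>) Z = emeasure (P (\<omega> k)) A * indicator B' \<omega>"
        using IT.emeasure_eP[OF w Z] by (simp add: PP_def n_def)
    qed
    also have "\<dots> = (\<integral>\<^sup>+\<omega>. emeasure (P (restrict \<omega> {0..<n} k)) A * indicator B' (restrict \<omega> {0..<n}) \<partial>L)"
      unfolding dL[symmetric] using mPk by (intro nn_integral_distr[OF rL]) simp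
    also have "\<dots> = (\<integral>\<^sup>+\<omega>. emeasure (P (\<phi> \<omega> (int k))) A * indicator B (\<phi> \<omega>) \<partial>L)"
      using \<phi>\<psi> by (intro nn_integral_cong) (auto simp: \<phi>_def n_def indicator_def)
    also have "\<dots> = (\<integral>\<^sup>+\<omega>. emeasure (P (\<omega> (int k))) A * indicator B \<omega> \<partial>Q)"
      unfolding Q_def using mPQ by (intro nn_integral_distr[OF m\<phi>, symmetric]) simp
    finally show ?thesis .
  qed
  have "is_chain_law E P \<mu> Q"
    unfolding is_chain_law_def
  proof (intro conjI allI impI ballI)
    fix k :: int and A assume k: "0 \<le> k" and A: "A \<in> sets E"
    show "AE \<omega> in Q. real_cond_exp Q (path_field E {0..k}) (indicator ((\<lambda>\<omega>. \<omega> (k + 1)) -` A \<inter> space Q)) \<omega>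
         = measure (P (\<omega> k)) A"
      unfolding is_chain_law_iff[OF P pQ sQ k A] using markov[OF A, of _ "nat k"] k by simp
  qed (use pQ sQ init in auto)
  then show ?thesis by blast
qed

lemma is_chain_law_chain_law:
  assumes "P \<in> E \<rightarrow>\<^sub>M prob_algebra E" "\<mu> \<in> space (prob_algebra E)"
  shows "is_chain_law E P \<mu> (chain_law E P \<mu>)"
  unfolding chain_law_def
  using is_chain_law_exists[OF assms] is_chain_law_unique[OF assms(1)] by (metis theI)

end

theory Submission
  imports Defs
begin

text \<open>
  The three conditions are proved in a cycle: ergodicity implies irreducibility, irreducibility implies
  triviality of the tail, and triviality implies ergodicity. The first implication is immediate,
  with \<open>\<alpha> = 1\<close>.

  From irreducibility to triviality. Let \<open>A\<close> be a tail event and \<open>A'\<close> the event that the path shifted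
  by \<open>- n\<close> lies in \<open>A\<close>; it is again a tail event, so irreducibility bounds the oscillation of
  \<open>x \<mapsto> P\<^sup>x(A')\<close> by \<open>c = 1 - \<alpha>/2\<close>, whatever \<open>n\<close> is. By the Markov property at time \<open>n\<close>, the conditional
  probability of \<open>A\<close> given a past event \<open>B\<close> is an average of this function
  (\<open>conditional_future_law\<close>, \<open>chain_law_oscillation\<close>). Comparing \<open>B\<close> with its complement gives
  \<open>Cov(A, B) \<le> c Var(B)\<close> (\<open>tail_covariance_bound\<close>). The past events \<open>B\<close> for varying \<open>n\<close> form an algebra
  that generates the whole \<open>\<sigma>\<close>-field, so \<open>B\<close> may be taken arbitrarily close to \<open>A\<close>, and
  \<open>Var(A) \<le> c Var(A)\<close> with \<open>c < 1\<close> forces \<open>Var(A) = 0\<close> (\<open>tail_trivial_of_uniform_bound\<close>). This replaces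
  the usual appeal to the martingale convergence \<open>P\<^sup>\<mu>(A | X\<^sub>0, \<dots>, X\<^sub>n) \<rightarrow> 1\<^sub>A\<close>.

  From triviality to ergodicity. The chain started from \<open>(\<mu> + \<nu>)/2\<close> is the average of the chains started
  from \<open>\<mu>\<close> and \<open>\<nu>\<close>, and its tail probabilities are 0 or 1 as well; so the two chains have the same tail
  probabilities (\<open>tail_trivial_imp_equal\<close>). Along a decreasing sequence of \<open>\<sigma>\<close>-fields the total
  variation distance tends to the one on the intersection, which is thus zero (\<open>tv_dist_tendsto_0\<close>).

  Both implications use that the chain law commutes with mixtures of initial laws (\<open>chain_law_bind\<close>), which
  rests on its measurable dependence on the initial law and on uniqueness.
\<close>

section \<open>Total variation along decreasing \<open>\<sigma>\<close>-fields\<close>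

lemma Hahn_set_of_subalgebra:
  fixes M N G :: "'b measure"
  assumes M: "finite_measure M" and N: "finite_measure N" and MN: "sets N = sets M"
    and G: "subalgebra M G"
  shows "\<exists>H\<in>sets G. \<forall>A\<in>sets G. measure M A - measure N A \<le> measure M H - measure N H"
proof -
  interpret M: finite_measure M by fact
  interpret N: finite_measure N by fact
  have G': "subalgebra N G"
    using G MN sets_eq_imp_space_eq[OF MN] by (simp add: subalgebra_def)
  have [measurable]: "A \<in> sets M" "A \<in> sets N" if "A \<in> sets G" for A
    using that G G' by (auto simp: subalgebra_def)
  obtain H where H: "H \<in> sets G"
    and pos: "\<And>A. A \<in> sets G \<Longrightarrow> A \<subseteq> H \<Longrightarrow> emeasure N A \<le> emeasure M A"
    and neg: "\<And>A. A \<in> sets G \<Longrightarrow> A \<inter> H = {} \<Longrightarrow> emeasure M A \<le> emeasure N A"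
    using finite_unsigned_Hahn_decomposition[of "restr_to_subalg M G" "restr_to_subalg N G"]
      finite_measure_restr_to_subalg[OF G M] finite_measure_restr_to_subalg[OF G' N]
    by (auto simp: sets_restr_to_subalg G G' emeasure_restr_to_subalg)
  show ?thesis
  proof (intro bexI[OF _ H] ballI)
    fix A assume A: "A \<in> sets G"
    have "measure N (H - A) \<le> measure M (H - A)" "measure M (A - H) \<le> measure N (A - H)"
      using pos[of "H - A"] neg[of "A - H"] A H by (auto simp: M.emeasure_eq_measure N.emeasure_eq_measure)
    moreover have "measure M A = measure M (A \<inter> H) + measure M (A - H)"
      "measure N A = measure N (A \<inter> H) + measure N (A - H)"
      "measure M H = measure M (A \<inter> H) + measure M (H - A)"
      "measure N H = measure N (A \<inter> H) + measure N (H - A)"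
      using A H by (auto simp: M.finite_measure_Diff' N.finite_measure_Diff' Int_commute)
    ultimately show "measure M A - measure N A \<le> measure M H - measure N H" by linarith
  qed
qed

text \<open>
  On a decreasing sequence of \<open>\<sigma>\<close>-fields the total variation distance cannot stay above the one on the
  intersection. Reverse martingales would give this; here a limsup of Hahn sets does. With \<open>D = M - N\<close>
  and \<open>H n\<close> maximising \<open>D\<close> on \<open>F n\<close>, every \<open>U\<close> in \<open>F j\<close> satisfies \<open>D (H j \<inter> U) \<le> D (H j)\<close>, hence
  \<open>D (H j \<union> U) \<ge> D U\<close>. So finite unions \<open>H j \<union> \<dots> \<union> H (j + k)\<close>, built up from the last set
  downwards, have at least the value of \<open>H (j + k)\<close>, which is at least \<open>d\<close>. The bound \<open>d\<close>
  passes to their double limit, the limsup of the \<open>H n\<close>, which lies in all the \<open>F n\<close>.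
\<close>
lemma tail_event_of_decreasing_subalgebras:
  fixes M N :: "'b measure" and F :: "nat \<Rightarrow> 'b measure"
  assumes M: "finite_measure M" and N: "finite_measure N" and MN: "sets N = sets M"
    and F: "\<And>n. subalgebra M (F n)" and dec: "decseq (\<lambda>n. sets (F n))"
    and d: "\<And>n. \<exists>A\<in>sets (F n). d \<le> measure M A - measure N A"
  shows "\<exists>A\<in>(\<Inter>n. sets (F n)). d \<le> measure M A - measure N A"
proof -
  interpret M: finite_measure M by fact
  interpret N: finite_measure N by fact
  define D where "D A = measure M A - measure N A" for A
  have inM: "A \<in> sets M" "A \<in> sets N" if "A \<in> sets (F n)" for A n
    using that F[of n] MN by (auto simp: subalgebra_def)
  have le: "sets (F n) \<subseteq> sets (F m)" if "m \<le> n" for m n using dec that by (simp add: decseq_def)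
  have D_Un: "D (A \<union> B) + D (A \<inter> B) = D A + D B" if "A \<in> sets (F n)" "B \<in> sets (F n)" for A B n
    using inM[OF that(1)] inM[OF that(2)] unfolding D_def
    by (simp add: M.finite_measure_Union' N.finite_measure_Union'
        M.finite_measure_Diff' N.finite_measure_Diff' Int_commute)
  have "\<exists>H. \<forall>n. H n \<in> sets (F n) \<and> (\<forall>A\<in>sets (F n). D A \<le> D (H n))"
    using Hahn_set_of_subalgebra[OF M N MN F] unfolding D_def by (intro choice) blast
  then obtain H where H: "\<And>n. H n \<in> sets (F n)"
    and Hmax: "\<And>n A. A \<in> sets (F n) \<Longrightarrow> D A \<le> D (H n)" by blast
  have Hd: "d \<le> D (H n)" for n
    using d[of n] Hmax[of _ n] unfolding D_def by (meson order_trans)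
  have HF: "H i \<in> sets (F n)" if "n \<le> i" for i n using H[of i] le[OF that] by blast
  \<comment> \<open>The finite unions whose limit in \<open>k\<close>, then in \<open>j\<close>, is the limsup.\<close>
  define U where "U j k = (\<Union>i\<in>{j..j + k}. H i)" for j k
  have UF: "U j k \<in> sets (F n)" if "n \<le> j" for j k n
    unfolding U_def using that by (intro sets.finite_UN) (auto intro: HF)
  have Ud: "d \<le> D (U j k)" for j k
  proof (induction k arbitrary: j)
    case 0
    then show ?case using Hd by (simp add: U_def)
  next
    case (Suc k)
    \<comment> \<open>Peel off the smallest index: the rest of the union is already in \<open>F j\<close>, where \<open>H j\<close> is maximal.\<close>
    have "{j..j + Suc k} = insert j {Suc j..Suc j + k}" by auto
    then have U: "U j (Suc k) = H j \<union> U (Suc j) k" unfolding U_def by simp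
    have UF': "U (Suc j) k \<in> sets (F j)" by (rule UF) simp
    have "D (H j \<inter> U (Suc j) k) \<le> D (H j)" using H UF' by (intro Hmax sets.Int)
    with D_Un[OF H UF'] have "D (U (Suc j) k) \<le> D (U j (Suc k))" unfolding U by linarith
    then show ?case using Suc.IH[of "Suc j"] by linarith
  qed
  define V where "V j = (\<Union>k. U j k)" for j
  have VF: "V j \<in> sets (F n)" if "n \<le> j" for j n
    unfolding V_def using UF[OF that] by auto
  have Vd: "d \<le> D (V j)" for j
  proof (rule LIMSEQ_le_const)
    have inc: "incseq (U j)" unfolding U_def by (intro monoI UN_mono) auto
    show "(\<lambda>k. D (U j k)) \<longlonglongrightarrow> D (V j)"
      unfolding D_def V_def using inM[OF UF[OF order_refl]] inc
      by (intro tendsto_diff M.finite_Lim_measure_incseq N.finite_Lim_measure_incseq) auto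
  qed (use Ud in blast)
  have V_Un: "V j = (\<Union>i\<in>{j..}. H i)" for j
  proof
    show "(\<Union>i\<in>{j..}. H i) \<subseteq> V j"
    proof
      fix x assume "x \<in> (\<Union>i\<in>{j..}. H i)"
      then obtain i where "j \<le> i" "x \<in> H i" by auto
      then have "x \<in> U j (i - j)" unfolding U_def by auto
      then show "x \<in> V j" unfolding V_def by blast
    qed
  qed (auto simp: V_def U_def)
  have Vdec: "decseq V" unfolding V_Un by (force simp: decseq_def)
  define W where "W = (\<Inter>j. V j)"
  have "d \<le> D W"
  proof (rule LIMSEQ_le_const)
    show "(\<lambda>j. D (V j)) \<longlonglongrightarrow> D W"
      unfolding D_def W_def using inM[OF VF[OF order_refl]] Vdec
      by (intro tendsto_diff M.finite_Lim_measure_decseq N.finite_Lim_measure_decseq) auto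
  qed (use Vd in blast)
  moreover have "W \<in> sets (F n)" for n
  proof -
    \<comment> \<open>Discarding the first \<open>n\<close> terms of the decreasing \<open>V\<close> exhibits \<open>W\<close> as an event of \<open>F n\<close>.\<close>
    have "W = (\<Inter>j. V (n + j))"
      unfolding W_def using decseqD[OF Vdec] by (auto simp: le_add2)  (meson le_add2 subsetD)
    then show ?thesis using VF[of n "n + _"] by auto
  qed
  ultimately show ?thesis unfolding D_def by blast
qed

lemma abs_diff_le_tv_dist:
  assumes "finite_measure M" "finite_measure N" "A \<in> sets G"
  shows "\<bar>measure M A - measure N A\<bar> \<le> tv_dist G M N / 2"
proof -
  have "\<bar>measure M A - measure N A\<bar> \<le> measure M (space M) + measure N (space N)" for A
    using finite_measure.bounded_measure[OF assms(1), of A] finite_measure.bounded_measure[OF assms(2), of A]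
      measure_nonneg[of M A] measure_nonneg[of N A] by linarith
  then have "\<bar>measure M A - measure N A\<bar> \<le> (SUP A\<in>sets G. \<bar>measure M A - measure N A\<bar>)"
    using assms(3) by (intro cSUP_upper bdd_aboveI2)
  then show ?thesis by (simp add: tv_dist_def)
qed

text \<open>
  If the distances did not tend to zero, then, after passing to complements, \<open>M - N\<close> would exceed a
  fixed positive value on some event of every \<open>F n\<close>, hence on an event of their intersection.
\<close>
lemma tv_dist_tendsto_0:
  fixes M N :: "'b measure" and F :: "nat \<Rightarrow> 'b measure"
  assumes M: "finite_measure M" and N: "finite_measure N" and MN: "sets N = sets M"
    and F: "\<And>n. subalgebra M (F n)" and dec: "decseq (\<lambda>n. sets (F n))"
    and eq: "\<And>A. A \<in> (\<Inter>n. sets (F n)) \<Longrightarrow> measure M A = measure N A"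
  shows "(\<lambda>n. tv_dist (F n) M N) \<longlonglongrightarrow> 0"
proof (rule LIMSEQ_I)
  interpret M: finite_measure M by fact
  interpret N: finite_measure N by fact
  fix r :: real assume r: "0 < r"
  have sp: "space M \<in> sets (F n)" for n using F[of n] sets.top[of "F n"] by (simp add: subalgebra_def)
  have inM: "A \<in> sets M" "A \<in> sets N" if "A \<in> sets (F n)" for A n
    using that F[of n] MN by (auto simp: subalgebra_def)
  \<comment> \<open>Any constant strictly below \<open>r / 2\<close> would do, since \<open>tv_dist\<close> carries a factor 2.\<close>
  have "\<not> (\<exists>A\<in>(\<Inter>n. sets (F n)). r / 3 \<le> measure M A - measure N A)" using eq r by auto
  then obtain n0 where n0: "\<And>A. A \<in> sets (F n0) \<Longrightarrow> measure M A - measure N A < r / 3"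
    using tail_event_of_decreasing_subalgebras[OF M N MN F dec, of "r / 3"] by (meson not_le)
  have abs: "\<bar>measure M A - measure N A\<bar> \<le> r / 3" if A: "A \<in> sets (F n0)" for A
  proof -
    \<comment> \<open>The one-sided bound for the complement is the other half of the two-sided bound for \<open>A\<close>.\<close>
    have "space M - A \<in> sets (F n0)" using sp A by (rule sets.Diff)
    moreover have "measure M (space M - A) = measure M (space M) - measure M A"
      "measure N (space M - A) = measure N (space M) - measure N A"
      using inM[OF A] M.finite_measure_compl[of A] N.finite_measure_compl[of A]
        sets_eq_imp_space_eq[OF MN] by auto
    moreover have "measure M (space M) = measure N (space M)" using eq sp by blast
    ultimately show ?thesis using n0[of "space M - A"] n0[OF A] by linarith
  qed
  show "\<exists>no. \<forall>n\<ge>no. norm (tv_dist (F n) M N - 0) < r"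
  proof (intro exI allI impI)
    fix n assume n: "n0 \<le> n"
    have "(SUP A\<in>sets (F n). \<bar>measure M A - measure N A\<bar>) \<le> r / 3"
      using sp[of n] dec n abs by (intro cSUP_least) (auto simp: decseq_def)
    moreover have "0 \<le> tv_dist (F n) M N"
      using order_trans[OF abs_ge_zero abs_diff_le_tv_dist[OF M N sp[of n]]] by simp
    ultimately show "norm (tv_dist (F n) M N - 0) < r" using r by (simp add: tv_dist_def)
  qed
qed

section \<open>Approximation by a generating algebra\<close>

text \<open>
  The events that can be approximated form a \<open>\<sigma>\<close>-field: complements keep the symmetric difference, and
  a countable union is first cut down to finitely many of its members, each of which is then
  approximated with an error small enough for the sum to remain below the given bound.
\<close>
lemma approximation_by_generating_algebra:
  assumes Q: "finite_measure Q" and G: "algebra (space Q) G" and gen: "sets Q = sigma_sets (space Q) G"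
    and A: "A \<in> sets Q" and e: "0 < e"
  shows "\<exists>B\<in>G. measure Q (A - B) + measure Q (B - A) < e"
proof -
  interpret finite_measure Q by fact
  interpret G: algebra "space Q" G by fact
  have GQ: "B \<in> sets Q" if "B \<in> G" for B using that gen by auto
  have "A \<in> sigma_sets (space Q) G" using A gen by simp
  then show ?thesis using e
  proof (induction arbitrary: e)
    case (Basic a)
    then show ?case by (intro bexI[of _ a]) auto
  next
    case Empty
    then show ?case by (intro bexI[of _ "{}"]) auto
  next
    case (Compl a)
    have a: "a \<subseteq> space Q" using Compl.hyps gen sets.sets_into_space[of a Q] by auto
    obtain B where B: "B \<in> G" "measure Q (a - B) + measure Q (B - a) < e"
      using Compl.IH[OF Compl.prems] by blast
    have "space Q - a - (space Q - B) = B - a" "space Q - B - (space Q - a) = a - B"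
      using a sets.sets_into_space[OF GQ[OF B(1)]] by auto
    with B show ?case by (intro bexI[of _ "space Q - B"]) (auto simp: add.commute)
  next
    case (Union a)
    have aQ: "a i \<in> sets Q" for i using Union.hyps gen by simp
    define U where "U n = (\<Union>i<n. a i)" for n
    have UQ: "U n \<in> sets Q" for n unfolding U_def using aQ by auto
    have U_inc: "incseq U" unfolding U_def by (intro monoI UN_mono) auto
    have "(\<lambda>n. measure Q (U n)) \<longlonglongrightarrow> measure Q (\<Union>n. U n)"
      using UQ U_inc by (intro finite_Lim_measure_incseq) auto
    moreover have "(\<Union>n. U n) = (\<Union>i. a i)" unfolding U_def by auto
    ultimately obtain n where "\<bar>measure Q (U n) - measure Q (\<Union>i. a i)\<bar> < e / 2"
      using Union.prems by (metis LIMSEQ_D half_gt_zero order_refl real_norm_def)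
    moreover have "measure Q ((\<Union>i. a i) - U n) = measure Q (\<Union>i. a i) - measure Q (U n)"
      using aQ UQ by (intro finite_measure_Diff) (auto simp: U_def)
    ultimately have n: "measure Q ((\<Union>i. a i) - U n) < e / 2" by linarith
    define e' where "e' = e / (2 * (real n + 1))"
    have "0 < e'" using Union.prems by (simp add: e'_def)
    then obtain B where B: "\<And>i. B i \<in> G" and Be: "\<And>i. measure Q (a i - B i) + measure Q (B i - a i) < e'"
      using Union.IH by metis
    define C where "C = (\<Union>i<n. B i)"
    have C: "C \<in> G" unfolding C_def using B by (intro G.finite_UN) auto
    have "measure Q ((\<Union>i. a i) - C) \<le> measure Q (((\<Union>i. a i) - U n) \<union> (\<Union>i<n. a i - B i))"
      using aQ UQ GQ[OF B] by (intro finite_measure_mono) (auto simp: U_def C_def)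
    also have "\<dots> \<le> measure Q ((\<Union>i. a i) - U n) + measure Q (\<Union>i<n. a i - B i)"
      using aQ UQ GQ[OF B] by (intro measure_Un_le) auto
    also have "measure Q (\<Union>i<n. a i - B i) \<le> (\<Sum>i<n. measure Q (a i - B i))"
      using aQ GQ[OF B] by (intro finite_measure_subadditive_finite) auto
    finally have 1: "measure Q ((\<Union>i. a i) - C) \<le> measure Q ((\<Union>i. a i) - U n) + (\<Sum>i<n. measure Q (a i - B i))"
      by simp
    have "measure Q (C - (\<Union>i. a i)) \<le> measure Q (\<Union>i<n. B i - a i)"
      using aQ GQ[OF B] by (intro finite_measure_mono) (auto simp: C_def)
    also have "\<dots> \<le> (\<Sum>i<n. measure Q (B i - a i))"
      using aQ GQ[OF B] by (intro finite_measure_subadditive_finite) auto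
    finally have "measure Q ((\<Union>i. a i) - C) + measure Q (C - (\<Union>i. a i))
        \<le> measure Q ((\<Union>i. a i) - U n) + (\<Sum>i<n. measure Q (a i - B i) + measure Q (B i - a i))"
      using 1 by (simp add: sum.distrib)
    also have "\<dots> \<le> measure Q ((\<Union>i. a i) - U n) + (\<Sum>i<n. e')"
      using Be by (intro add_left_mono sum_mono) (simp add: less_imp_le)
    also have "\<dots> < e / 2 + real n * e'" using n by simp
    also have "\<dots> \<le> e" using Union.prems by (simp add: e'_def field_simps)
    finally show ?case using C by blast
  qed
qed

section \<open>Shifts and finite horizons on the path space\<close>

lemma space_path_field_eq: "space (path_field G I) = {\<omega>. \<forall>k. \<omega> k \<in> space G}"
  by (auto simp: space_path_field space_PiM)

text \<open>
  Since paths are indexed by all integers, the shift by \<open>j\<close> is a bijection with inverse the shift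
  by \<open>- j\<close>; this is what allows a tail event to be transported back to time 0.
\<close>
definition path_shift :: "int \<Rightarrow> (int \<Rightarrow> 'a) \<Rightarrow> int \<Rightarrow> 'a" where
  "path_shift j \<omega> = (\<lambda>k. \<omega> (k + j))"

lemma measurable_path_shift:
  assumes "\<And>i. i \<in> I \<Longrightarrow> i + j \<in> J"
  shows "path_shift j \<in> path_field G J \<rightarrow>\<^sub>M path_field G I"
proof (rule measurable_path_fieldI)
  show "path_shift j \<omega> \<in> space (\<Pi>\<^sub>M k\<in>UNIV. G)" if "\<omega> \<in> space (path_field G J)" for \<omega>
    using that by (auto simp: path_shift_def space_path_field_eq space_PiM)
  show "(\<lambda>\<omega>. path_shift j \<omega> i) \<in> path_field G J \<rightarrow>\<^sub>M G" if "i \<in> I" for i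
    unfolding path_shift_def using assms[OF that] by (rule component_path_field)
qed

text \<open>
  The tail \<open>\<sigma>\<close>-field is invariant under shifts in both directions: an event that depends only on the
  coordinates from \<open>n - j\<close> on becomes one that depends only on the coordinates from \<open>n\<close> on.
\<close>
lemma path_shift_in_path_tail:
  assumes "A \<in> path_tail G"
  shows "path_shift j -` A \<inter> space (path_field G I) \<in> path_tail G"
  unfolding path_tail_def
proof (intro INT_I)
  fix n :: nat
  have "A \<in> sets (path_field G {int (nat (int n - j))..})"
    using assms unfolding path_tail_def by blast
  moreover have "path_shift j \<in> path_field G {int n..} \<rightarrow>\<^sub>M path_field G {int (nat (int n - j))..}"
    by (rule measurable_path_shift) (auto split: if_splits)
  ultimately have "path_shift j -` A \<inter> space (path_field G {int n..}) \<in> sets (path_field G {int n..})"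
    by (rule measurable_sets[rotated])
  then show "path_shift j -` A \<inter> space (path_field G I) \<in> sets (path_field G {int n..})"
    by (simp add: space_path_field)
qed

lemma path_field_Int_component:
  assumes "B \<in> sets (path_field G I)" "A \<in> sets G" "i \<in> I"
  shows "B \<inter> (\<lambda>\<omega>. \<omega> i) -` A \<in> sets (path_field G I)"
proof -
  have "B \<inter> (\<lambda>\<omega>. \<omega> i) -` A = B \<inter> ((\<lambda>\<omega>. \<omega> i) -` A \<inter> space (path_field G I))"
    using sets.sets_into_space[OF assms(1)] by auto
  also have "\<dots> \<in> sets (path_field G I)"
    using assms by (intro sets.Int measurable_sets[OF component_path_field])
  finally show ?thesis .
qed

lemma subalgebra_path_field: "I \<subseteq> J \<Longrightarrow> subalgebra (path_field G J) (path_field G I)"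
  by (simp add: subalgebra_def sets_path_field_mono space_path_field)

text \<open>
  A generator for one more coordinate that has the form in which the Markov property is stated.
\<close>
lemma sets_path_field_insert:
  "sets (path_field G (insert i I)) = sigma_sets (space (path_field G I))
     {B \<inter> (\<lambda>\<omega>. \<omega> i) -` A | A B. A \<in> sets G \<and> B \<in> sets (path_field G I)}" (is "_ = sigma_sets ?\<Omega> ?R")
proof
  have "?R \<subseteq> sets (path_field G (insert i I))"
    using sets_path_field_mono[of I "insert i I" G] by (auto intro!: path_field_Int_component)
  from sets.sigma_sets_subset[OF this] show "sigma_sets ?\<Omega> ?R \<subseteq> sets (path_field G (insert i I))"
    by (simp add: space_path_field)
  show "sets (path_field G (insert i I)) \<subseteq> sigma_sets ?\<Omega> ?R"
    unfolding sets_path_field[of G "insert i I"] space_path_field[of G I]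
  proof (rule sigma_sets_mono', rule subsetI)
    let ?P = "space (\<Pi>\<^sub>M k\<in>(UNIV :: int set). G)"
    have mem: "B \<inter> (\<lambda>\<omega>. \<omega> i) -` A \<in> ?R" if "A \<in> sets G" "B \<in> sets (path_field G I)" for A B
      using that by blast
    fix X assume "X \<in> (\<Union>k\<in>insert i I. {(\<lambda>\<omega>. \<omega> k) -` A \<inter> ?P | A. A \<in> sets G})"
    then obtain k A where k: "k = i \<or> k \<in> I" and A: "A \<in> sets G"
      and X: "X = (\<lambda>\<omega>. \<omega> k) -` A \<inter> ?P" by blast
    from k show "X \<in> ?R"
    proof
      assume "k = i"
      then show ?thesis
        using mem[OF A sets.top] unfolding X by (simp add: space_path_field Int_commute)
    next
      assume "k \<in> I"
      then have kI: "X \<in> sets (path_field G I)"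
        unfolding X using measurable_sets[OF component_path_field A] by (metis space_path_field)
      have "X = X \<inter> (\<lambda>\<omega>. \<omega> i) -` space G" by (auto simp: X space_PiM)
      then show ?thesis using mem[OF sets.top kI] by simp
    qed
  qed
qed

lemma finite_horizon_mono:
  "m \<le> n \<Longrightarrow> sets (path_field G {0..int m}) \<subseteq> sets (path_field G {0..int n})"
  by (rule sets_path_field_mono) auto

text \<open>
  Events decided by finitely many steps form an algebra; it generates the future \<open>\<sigma>\<close>-field, and so
  determines measurability of kernels and approximates every event.
\<close>
lemma algebra_finite_horizon:
  "algebra (space (path_field G {0..})) (\<Union>n. sets (path_field G {0..int n}))"
  unfolding algebra_iff_Int
proof (intro conjI ballI)
  let ?\<Omega> = "space (path_field G {0..})"
  show "(\<Union>n. sets (path_field G {0..int n})) \<subseteq> Pow ?\<Omega>"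
    using sets.sets_into_space by (fastforce simp: space_path_field)
  show "{} \<in> (\<Union>n. sets (path_field G {0..int n}))" by simp
  fix A assume "A \<in> (\<Union>n. sets (path_field G {0..int n}))"
  then obtain m where A: "A \<in> sets (path_field G {0..int m})" by blast
  then show "?\<Omega> - A \<in> (\<Union>n. sets (path_field G {0..int n}))"
    using sets.compl_sets[OF A] unfolding space_path_field by blast
  fix B assume "B \<in> (\<Union>n. sets (path_field G {0..int n}))"
  then obtain n where B: "B \<in> sets (path_field G {0..int n})" by blast
  have "A \<inter> B \<in> sets (path_field G {0..int (max m n)})"
    using A B finite_horizon_mono[of m "max m n" G] finite_horizon_mono[of n "max m n" G] by auto
  then show "A \<inter> B \<in> (\<Union>n. sets (path_field G {0..int n}))" by blast
qed

lemma sets_path_field_finite_horizon: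
  "sets (path_field G {0..}) =
     sigma_sets (space (path_field G {0..})) (\<Union>n. sets (path_field G {0..int n}))"
proof
  have "(\<Union>n. sets (path_field G {0..int n})) \<subseteq> sets (path_field G {0..})"
    by (intro UN_least sets_path_field_mono) auto
  then show "sigma_sets (space (path_field G {0..})) (\<Union>n. sets (path_field G {0..int n}))
      \<subseteq> sets (path_field G {0..})" by (rule sets.sigma_sets_subset)
  show "sets (path_field G {0..}) \<subseteq>
      sigma_sets (space (path_field G {0..})) (\<Union>n. sets (path_field G {0..int n}))"
    unfolding sets_path_field[of G "{0..}"] space_path_field
  proof (rule sigma_sets_mono', safe)
    fix i :: int and A assume i: "0 \<le> i" and A: "A \<in> sets G"
    have "(\<lambda>\<omega>. \<omega> i) -` A \<inter> space (path_field G {0..int (nat i)}) \<in> sets (path_field G {0..int (nat i)})"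
      using i A by (intro measurable_sets[OF component_path_field]) auto
    then show "(\<lambda>\<omega>. \<omega> i) -` A \<inter> space (\<Pi>\<^sub>M k\<in>UNIV. G) \<in> (\<Union>n. sets (path_field G {0..int n}))"
      unfolding space_path_field by blast
  qed
qed

section \<open>Markov laws: mixtures and conditioning\<close>

text \<open>
  The Markov property without an initial law, with the conditional expectation replaced by its defining
  integral identity: in this form it can be seen to survive mixing, conditioning and shifting.
\<close>
definition markov_law :: "'a measure \<Rightarrow> ('a \<Rightarrow> 'a measure) \<Rightarrow> (int \<Rightarrow> 'a) measure \<Rightarrow> bool" where
  "markov_law E P Q \<longleftrightarrow>
    prob_space Q \<and> sets Q = sets (path_field E {0..}) \<and>
    (\<forall>k\<ge>0. \<forall>A\<in>sets E. \<forall>B\<in>sets (path_field E {0..k}).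
       emeasure Q (B \<inter> (\<lambda>\<omega>. \<omega> (k + 1)) -` A) =
         (\<integral>\<^sup>+\<omega>. emeasure (P (\<omega> k)) A * indicator B \<omega> \<partial>Q))"

lemma is_chain_law_iff_markov_law:
  assumes "P \<in> E \<rightarrow>\<^sub>M prob_algebra E"
  shows "is_chain_law E P \<mu> Q \<longleftrightarrow> markov_law E P Q \<and> distr Q E (\<lambda>\<omega>. \<omega> 0) = \<mu>"
  using is_chain_law_iff[OF assms] unfolding is_chain_law_def markov_law_def by blast

lemma markov_lawD:
  assumes "markov_law E P Q"
  shows "prob_space Q" "sets Q = sets (path_field E {0..})" "space Q = space (path_field E {0..})"
    "Q \<in> space (prob_algebra (path_field E {0..}))"
    "\<lbrakk>0 \<le> k; A \<in> sets E; B \<in> sets (path_field E {0..k})\<rbrakk> \<Longrightarrow>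
       emeasure Q (B \<inter> (\<lambda>\<omega>. \<omega> (k + 1)) -` A) = (\<integral>\<^sup>+\<omega>. emeasure (P (\<omega> k)) A * indicator B \<omega> \<partial>Q)"
  using assms sets_eq_imp_space_eq[of Q "path_field E {0..}"]
  by (auto simp: markov_law_def space_prob_algebra)

lemma borel_measurable_transition:
  assumes P: "P \<in> E \<rightarrow>\<^sub>M prob_algebra E" and "k \<in> I" "A \<in> sets E" "B \<in> sets (path_field E I)"
  shows "(\<lambda>\<omega>. emeasure (P (\<omega> k)) A * indicator B \<omega>) \<in> borel_measurable (path_field E I)"
  using assms(2-) by (intro borel_measurable_times_ennreal borel_measurable_indicator
      measurable_compose[OF measurable_compose[OF component_path_field measurable_prob_algebraD[OF P]]
        measurable_emeasure_subprob_algebra])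

text \<open>
  The identity that defines a Markov law is linear in the law, so it passes to mixtures.
\<close>
lemma markov_law_bind:
  assumes P: "P \<in> E \<rightarrow>\<^sub>M prob_algebra E" and M: "M \<in> space (prob_algebra L)"
    and K: "K \<in> L \<rightarrow>\<^sub>M prob_algebra (path_field E {0..})"
    and law: "\<And>t. t \<in> space L \<Longrightarrow> markov_law E P (K t)"
  shows "markov_law E P (M \<bind> K)"
  unfolding markov_law_def
proof (intro conjI allI impI ballI)
  show "prob_space (M \<bind> K)" using M K by (rule prob_space_bind')
  show "sets (M \<bind> K) = sets (path_field E {0..})" using M K by (rule sets_bind')
  fix k :: int and A B
  assume k: "0 \<le> k" and A: "A \<in> sets E" and B: "B \<in> sets (path_field E {0..k})"
  have sub: "sets (path_field E {0..k}) \<subseteq> sets (path_field E {0..})"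
    by (rule sets_path_field_mono) auto
  have sM: "sets M = sets L" "space M = space L"
    using M by (auto simp: space_prob_algebra dest: sets_eq_imp_space_eq)
  have "emeasure (M \<bind> K) (B \<inter> (\<lambda>\<omega>. \<omega> (k + 1)) -` A)
      = (\<integral>\<^sup>+t. emeasure (K t) (B \<inter> (\<lambda>\<omega>. \<omega> (k + 1)) -` A) \<partial>M)"
    using k A B sub by (intro emeasure_bind_prob_algebra[OF M K] path_field_Int_component) auto
  also have "\<dots> = (\<integral>\<^sup>+t. (\<integral>\<^sup>+\<omega>. emeasure (P (\<omega> k)) A * indicator B \<omega> \<partial>K t) \<partial>M)"
    using markov_lawD(5)[OF law k A B] by (intro nn_integral_cong) (simp add: sM)
  also have "\<dots> = (\<integral>\<^sup>+\<omega>. emeasure (P (\<omega> k)) A * indicator B \<omega> \<partial>(M \<bind> K))"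
  proof (rule nn_integral_bind[symmetric])
    show "(\<lambda>\<omega>. emeasure (P (\<omega> k)) A * indicator B \<omega>) \<in> borel_measurable (path_field E {0..})"
      using k A B sub by (intro borel_measurable_transition[OF P]) auto
    show "K \<in> M \<rightarrow>\<^sub>M subprob_algebra (path_field E {0..})"
      using measurable_prob_algebraD[OF K] by (simp add: measurable_cong_sets[OF sM(1) refl])
  qed
  finally show "emeasure (M \<bind> K) (B \<inter> (\<lambda>\<omega>. \<omega> (k + 1)) -` A)
      = (\<integral>\<^sup>+\<omega>. emeasure (P (\<omega> k)) A * indicator B \<omega> \<partial>(M \<bind> K))" .
qed

text \<open>
  The Markov property at a fixed time \<open>n\<close>: conditionally on any event \<open>B\<close> of the past, the future
  restarted at time \<open>n\<close> is again a Markov chain with the same kernel. A past event of the shifted chain,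
  intersected with \<open>B\<close>, is a past event of the original chain, and for that the identity is known.
\<close>
lemma markov_law_conditional_shift:
  assumes P: "P \<in> E \<rightarrow>\<^sub>M prob_algebra E" and Q: "markov_law E P Q"
    and n: "0 \<le> n" and B: "B \<in> sets (path_field E {0..n})" and pos: "emeasure Q B \<noteq> 0"
  shows "markov_law E P (distr (uniform_measure Q B) (path_field E {0..}) (path_shift n))"
    (is "markov_law E P ?R")
  unfolding markov_law_def
proof (intro conjI allI impI ballI)
  interpret prob_space Q using Q by (rule markov_lawD)
  have sQ: "sets Q = sets (path_field E {0..})" and spQ: "space Q = space (path_field E {0..})"
    using Q by (rule markov_lawD)+
  have inQ: "C \<in> sets Q" if "C \<in> sets (path_field E {0..k})" for C k
    using that sets_path_field_mono[of "{0..k}" "{0..}" E] by (auto simp: sQ)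
  have shift: "path_shift n \<in> Q \<rightarrow>\<^sub>M path_field E {0..}"
    unfolding measurable_cong_sets[OF sQ refl] using n by (intro measurable_path_shift) auto
  then have shift': "path_shift n \<in> uniform_measure Q B \<rightarrow>\<^sub>M path_field E {0..}" by simp
  show "prob_space ?R"
    by (intro prob_space.prob_space_distr prob_space_uniform_measure shift' pos) simp
  show "sets ?R = sets (path_field E {0..})" by simp
  fix k :: int and A C
  assume k: "0 \<le> k" and A: "A \<in> sets E" and C: "C \<in> sets (path_field E {0..k})"
  let ?C = "path_shift n -` C \<inter> space Q"
  have "?C \<in> sets (path_field E {0..k + n})"
    using measurable_sets[OF measurable_path_shift C, of n "{0..k + n}"] n
    by (simp add: spQ space_path_field)
  moreover have "B \<in> sets (path_field E {0..k + n})"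
    using B sets_path_field_mono[of "{0..n}" "{0..k + n}" E] k by auto
  ultimately have BC: "B \<inter> ?C \<in> sets (path_field E {0..k + n})" by blast
  have CA: "C \<inter> (\<lambda>\<omega>. \<omega> (k + 1)) -` A \<in> sets (path_field E {0..})"
    using C A k sets_path_field_mono[of "{0..k}" "{0..}" E] by (intro path_field_Int_component) auto
  have f: "(\<lambda>\<omega>. emeasure (P (\<omega> k)) A * indicator C \<omega>) \<in> borel_measurable (path_field E {0..})"
    using k A C sets_path_field_mono[of "{0..k}" "{0..}" E]
    by (intro borel_measurable_transition[OF P]) auto
  have "emeasure ?R (C \<inter> (\<lambda>\<omega>. \<omega> (k + 1)) -` A) =
      emeasure Q (B \<inter> (path_shift n -` (C \<inter> (\<lambda>\<omega>. \<omega> (k + 1)) -` A) \<inter> space Q)) / emeasure Q B"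
    using measurable_sets[OF shift CA] inQ[OF B]
    by (simp add: emeasure_distr[OF shift' CA])
  also have "B \<inter> (path_shift n -` (C \<inter> (\<lambda>\<omega>. \<omega> (k + 1)) -` A) \<inter> space Q)
      = (B \<inter> ?C) \<inter> (\<lambda>\<omega>. \<omega> (k + n + 1)) -` A"
    by (auto simp: path_shift_def add.commute add.left_commute)
  also have "emeasure Q \<dots> = (\<integral>\<^sup>+\<omega>. emeasure (P (\<omega> (k + n))) A * indicator (B \<inter> ?C) \<omega> \<partial>Q)"
    using k n by (intro markov_lawD(5)[OF Q] A BC) simp
  also have "\<dots> = (\<integral>\<^sup>+\<omega>. (emeasure (P (path_shift n \<omega> k)) A * indicator C (path_shift n \<omega>)) * indicator B \<omega> \<partial>Q)"
    by (intro nn_integral_cong) (auto simp: path_shift_def indicator_def)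
  also have "\<dots> / emeasure Q B =
      (\<integral>\<^sup>+\<omega>. emeasure (P (path_shift n \<omega> k)) A * indicator C (path_shift n \<omega>) \<partial>uniform_measure Q B)"
    using measurable_compose[OF shift f] inQ[OF B] by (intro nn_integral_uniform_measure[symmetric]) auto
  also have "\<dots> = (\<integral>\<^sup>+\<omega>. emeasure (P (\<omega> k)) A * indicator C \<omega> \<partial>?R)"
    using f by (intro nn_integral_distr[OF shift', symmetric]) simp
  finally show "emeasure ?R (C \<inter> (\<lambda>\<omega>. \<omega> (k + 1)) -` A)
      = (\<integral>\<^sup>+\<omega>. emeasure (P (\<omega> k)) A * indicator C \<omega> \<partial>?R)" .
qed

section \<open>Dependence of the chain law on the initial law\<close>

text \<open>
  The law of the chain depends measurably on the initial law. On the horizon \<open>{0}\<close> the law is the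
  initial law itself; passing from the horizon \<open>n\<close> to \<open>n + 1\<close> integrates a function of the first \<open>n\<close>
  steps against the law on the horizon \<open>n\<close>. Dynkin's theorem extends measurability from generators to the
  \<open>\<sigma>\<close>-field of each horizon, and from all horizons together to the whole future. The restriction to a
  horizon is needed because the induction hypothesis concerns that smaller \<open>\<sigma>\<close>-field only.
\<close>
lemma measurable_chain_law:
  assumes P: "P \<in> E \<rightarrow>\<^sub>M prob_algebra E"
  shows "chain_law E P \<in> prob_algebra E \<rightarrow>\<^sub>M prob_algebra (path_field E {0..})"
proof -
  let ?K = "chain_law E P"
  let ?F = "\<lambda>n. path_field E {0..int n}"
  let ?\<Omega> = "space (path_field E {0..})"
  have law: "markov_law E P (?K \<mu>)" and init: "distr (?K \<mu>) E (\<lambda>\<omega>. \<omega> 0) = \<mu>"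
    if "\<mu> \<in> space (prob_algebra E)" for \<mu>
    using is_chain_law_chain_law[OF P that] by (auto simp: is_chain_law_iff_markov_law[OF P])
  have sub: "subalgebra (?K \<mu>) (?F n)" if "\<mu> \<in> space (prob_algebra E)" for \<mu> n
    using subalgebra_path_field[of "{0..int n}" "{0..}" E] markov_lawD(2,3)[OF law[OF that]]
    by (simp add: subalgebra_def)
  have prob: "prob_space (restr_to_subalg (?K \<mu>) (?F n))" if "\<mu> \<in> space (prob_algebra E)" for \<mu> n
    using sub[OF that] markov_lawD(1)[OF law[OF that]] by (rule prob_space_restr_to_subalg)
  have restr: "(\<lambda>\<mu>. restr_to_subalg (?K \<mu>) (?F n)) \<in> prob_algebra E \<rightarrow>\<^sub>M prob_algebra (?F n)" for n
  proof (induction n)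
    case 0
    let ?G = "{(\<lambda>\<omega>. \<omega> 0) -` A \<inter> ?\<Omega> | A. A \<in> sets E}"
    show ?case
    proof (rule measurable_prob_algebra_generated[where G="?G" and \<Omega>="?\<Omega>"])
      show "sets (?F 0) = sigma_sets ?\<Omega> ?G" by (simp add: sets_path_field space_path_field)
      show "Int_stable ?G"
      proof (rule Int_stableI)
        fix a b assume "a \<in> ?G" "b \<in> ?G"
        then obtain A B where "A \<in> sets E" "B \<in> sets E"
          "a = (\<lambda>\<omega>. \<omega> 0) -` A \<inter> ?\<Omega>" "b = (\<lambda>\<omega>. \<omega> 0) -` B \<inter> ?\<Omega>" by blast
        then show "a \<inter> b \<in> ?G" by (intro CollectI exI[of _ "A \<inter> B"]) auto
      qed
      fix a assume "a \<in> ?G"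
      then obtain A where A: "A \<in> sets E" "a = (\<lambda>\<omega>. \<omega> 0) -` A \<inter> ?\<Omega>" by blast
      have "emeasure (restr_to_subalg (?K \<mu>) (?F 0)) a = emeasure \<mu> A"
        if \<mu>: "\<mu> \<in> space (prob_algebra E)" for \<mu>
      proof -
        have sQ: "sets (?K \<mu>) = sets (path_field E {0..})" and spQ: "space (?K \<mu>) = ?\<Omega>"
          using law[OF \<mu>] by (rule markov_lawD)+
        have X: "(\<lambda>\<omega>. \<omega> 0) \<in> ?K \<mu> \<rightarrow>\<^sub>M E"
          unfolding measurable_cong_sets[OF sQ refl] by (rule component_path_field) simp
        have "a \<in> sets (?F 0)"
          using measurable_sets[OF component_path_field[of 0 "{0..int 0}" E] A(1)] A(2)
          by (simp add: space_path_field)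
        then have "emeasure (restr_to_subalg (?K \<mu>) (?F 0)) a = emeasure (?K \<mu>) a"
          by (rule emeasure_restr_to_subalg[OF sub[OF \<mu>]])
        also have "\<dots> = emeasure (distr (?K \<mu>) E (\<lambda>\<omega>. \<omega> 0)) A"
          using A by (simp add: emeasure_distr[OF X] spQ)
        finally show ?thesis by (simp add: init[OF \<mu>])
      qed
      then show "(\<lambda>\<mu>. emeasure (restr_to_subalg (?K \<mu>) (?F 0)) a) \<in> borel_measurable (prob_algebra E)"
        using measurable_compose[OF measurable_prob_algebraD[OF measurable_ident] measurable_emeasure_subprob_algebra[OF A(1)]]
        by (subst measurable_cong) auto
    qed (use prob[of _ 0] sets_restr_to_subalg[OF sub, of _ 0] in auto)
  next
    case (Suc n)
    have ins: "{0..int (Suc n)} = insert (int n + 1) {0..int n}" by auto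
    let ?G = "{B \<inter> (\<lambda>\<omega>. \<omega> (int n + 1)) -` A | A B. A \<in> sets E \<and> B \<in> sets (?F n)}"
    show ?case
    proof (rule measurable_prob_algebra_generated[where G="?G" and \<Omega>="space (?F n)"])
      show gen: "sets (?F (Suc n)) = sigma_sets (space (?F n)) ?G"
        unfolding ins by (rule sets_path_field_insert)
      show "Int_stable ?G"
      proof (rule Int_stableI)
        fix a b assume "a \<in> ?G" "b \<in> ?G"
        then obtain A B A' B' where AB: "A \<in> sets E" "B \<in> sets (?F n)" "A' \<in> sets E" "B' \<in> sets (?F n)"
          and ab: "a = B \<inter> (\<lambda>\<omega>. \<omega> (int n + 1)) -` A" "b = B' \<inter> (\<lambda>\<omega>. \<omega> (int n + 1)) -` A'" by blast
        have "a \<inter> b = (B \<inter> B') \<inter> (\<lambda>\<omega>. \<omega> (int n + 1)) -` (A \<inter> A')" unfolding ab by auto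
        then show "a \<inter> b \<in> ?G" using AB sets.Int by blast
      qed
      show "?G \<subseteq> Pow (space (?F n))" using sets.sets_into_space by blast
      fix a assume a: "a \<in> ?G"
      then obtain A B where A: "A \<in> sets E" and B: "B \<in> sets (?F n)"
        and aAB: "a = B \<inter> (\<lambda>\<omega>. \<omega> (int n + 1)) -` A" by blast
      let ?f = "\<lambda>\<omega>. emeasure (P (\<omega> (int n))) A * indicator B \<omega>"
      have f: "?f \<in> borel_measurable (?F n)" using A B by (intro borel_measurable_transition[OF P]) auto
      have "emeasure (restr_to_subalg (?K \<mu>) (?F (Suc n))) a
          = (\<integral>\<^sup>+\<omega>. ?f \<omega> \<partial>restr_to_subalg (?K \<mu>) (?F n))" if \<mu>: "\<mu> \<in> space (prob_algebra E)" for \<mu>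
      proof -
        have "a \<in> sets (?F (Suc n))" unfolding gen using a by (rule sigma_sets.Basic)
        then have "emeasure (restr_to_subalg (?K \<mu>) (?F (Suc n))) a = emeasure (?K \<mu>) a"
          by (rule emeasure_restr_to_subalg[OF sub[OF \<mu>]])
        also have "\<dots> = (\<integral>\<^sup>+\<omega>. ?f \<omega> \<partial>?K \<mu>)"
          unfolding aAB by (rule markov_lawD(5)[OF law[OF \<mu>] _ A B]) simp
        finally show ?thesis by (simp add: nn_integral_subalgebra2[OF sub[OF \<mu>] f])
      qed
      then show "(\<lambda>\<mu>. emeasure (restr_to_subalg (?K \<mu>) (?F (Suc n))) a) \<in> borel_measurable (prob_algebra E)"
        using measurable_compose[OF measurable_prob_algebraD[OF Suc.IH] nn_integral_measurable_subprob_algebra[OF f]]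
        by (subst measurable_cong) auto
    qed (use prob[of _ "Suc n"] sets_restr_to_subalg[OF sub, of _ "Suc n"] in auto)
  qed
  show ?thesis
  proof (rule measurable_prob_algebra_generated[OF sets_path_field_finite_horizon])
    interpret algebra ?\<Omega> "\<Union>n. sets (?F n)" by (rule algebra_finite_horizon)
    show "Int_stable (\<Union>n. sets (?F n))" by (rule Int_stable)
    show "(\<Union>n. sets (?F n)) \<subseteq> Pow ?\<Omega>" by (rule space_closed)
    fix a assume "a \<in> (\<Union>n. sets (?F n))"
    then obtain n where a: "a \<in> sets (?F n)" by blast
    show "(\<lambda>\<mu>. emeasure (?K \<mu>) a) \<in> borel_measurable (prob_algebra E)"
      using measurable_compose[OF measurable_prob_algebraD[OF restr] measurable_emeasure_subprob_algebra[OF a]]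
      by (subst measurable_cong[OF emeasure_restr_to_subalg[OF sub a, symmetric]]) auto
  qed (use law in \<open>auto dest: markov_lawD\<close>)
qed

text \<open>
  A mixture of chain laws is a Markov law, and its initial law is the mixture of the initial laws;
  uniqueness identifies it. Two instances matter: mixing point masses by \<open>\<mu>\<close> recovers the chain started
  from \<open>\<mu>\<close>, and mixing two initial laws with weights \<open>1/2\<close> averages the two chains.
\<close>
lemma chain_law_bind:
  assumes P: "P \<in> E \<rightarrow>\<^sub>M prob_algebra E" and M: "M \<in> space (prob_algebra L)"
    and m: "m \<in> L \<rightarrow>\<^sub>M prob_algebra E"
  shows "chain_law E P (M \<bind> m) = M \<bind> (\<lambda>t. chain_law E P (m t))"
proof (rule is_chain_law_unique[OF P])
  let ?K = "\<lambda>t. chain_law E P (m t)"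
  have sM: "sets M = sets L" "space M = space L" and pM: "prob_space M"
    using M by (auto simp: space_prob_algebra dest: sets_eq_imp_space_eq)
  from pM have ne: "space M \<noteq> {}" by (rule prob_space.not_empty)
  have mt: "m t \<in> space (prob_algebra E)" if "t \<in> space L" for t
    using m that by (rule measurable_space)
  have law: "markov_law E P (?K t)" and init: "distr (?K t) E (\<lambda>\<omega>. \<omega> 0) = m t" if "t \<in> space L" for t
    using is_chain_law_chain_law[OF P mt[OF that]] by (auto simp: is_chain_law_iff_markov_law[OF P])
  have K: "?K \<in> L \<rightarrow>\<^sub>M prob_algebra (path_field E {0..})"
    using m measurable_chain_law[OF P] by (rule measurable_compose)
  then have K': "?K \<in> M \<rightarrow>\<^sub>M subprob_algebra (path_field E {0..})"
    using measurable_prob_algebraD by (simp add: measurable_cong_sets[OF sM(1) refl])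
  show "is_chain_law E P (M \<bind> m) (chain_law E P (M \<bind> m))"
    using prob_space_bind'[OF M m] sets_bind'[OF M m]
    by (intro is_chain_law_chain_law[OF P]) (simp add: space_prob_algebra)
  have "distr (M \<bind> ?K) E (\<lambda>\<omega>. \<omega> 0) = M \<bind> (\<lambda>t. distr (?K t) E (\<lambda>\<omega>. \<omega> 0))"
    using K' ne by (rule distr_bind) (simp add: component_path_field)
  also have "\<dots> = M \<bind> m"
    using init by (intro bind_cong) (auto simp: sM)
  finally show "is_chain_law E P (M \<bind> m) (M \<bind> ?K)"
    using markov_law_bind[OF P M K law] by (simp add: is_chain_law_iff_markov_law[OF P])
qed

lemma chain_law_props:
  assumes "P \<in> E \<rightarrow>\<^sub>M prob_algebra E" "\<mu> \<in> space (prob_algebra E)"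
  shows "markov_law E P (chain_law E P \<mu>)" "prob_space (chain_law E P \<mu>)"
    "sets (chain_law E P \<mu>) = sets (path_field E {0..})"
    "space (chain_law E P \<mu>) = space (path_field E {0..})"
proof -
  show "markov_law E P (chain_law E P \<mu>)"
    using is_chain_law_chain_law[OF assms] by (simp add: is_chain_law_iff_markov_law[OF assms(1)])
  then show "prob_space (chain_law E P \<mu>)"
    "sets (chain_law E P \<mu>) = sets (path_field E {0..})"
    "space (chain_law E P \<mu>) = space (path_field E {0..})"
    by (rule markov_lawD)+
qed

lemma return_in_prob_algebra: "x \<in> space E \<Longrightarrow> return E x \<in> space (prob_algebra E)"
  by (simp add: space_prob_algebra prob_space_return)

lemma measurable_return_prob_algebra: "return E \<in> E \<rightarrow>\<^sub>M prob_algebra E"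
  by (rule measurable_prob_algebraI) (auto simp: prob_space_return)

text \<open>
  The chain law from \<open>\<mu>\<close> is the \<open>\<mu>\<close>-average of those from points, and averages of a function differ by
  no more than its oscillation. This transfers a bound for pairs of starting points to pairs of initial laws.
\<close>
lemma chain_law_oscillation:
  assumes P: "P \<in> E \<rightarrow>\<^sub>M prob_algebra E" and C: "C \<in> sets (path_field E {0..})"
    and \<mu>: "\<mu> \<in> space (prob_algebra E)" and \<nu>: "\<nu> \<in> space (prob_algebra E)"
    and osc: "\<And>x x'. x \<in> space E \<Longrightarrow> x' \<in> space E \<Longrightarrow>
      measure (chain_law E P (return E x)) C - measure (chain_law E P (return E x')) C \<le> c"
  shows "measure (chain_law E P \<mu>) C - measure (chain_law E P \<nu>) C \<le> c"
proof -
  let ?K = "\<lambda>x. chain_law E P (return E x)"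
  let ?f = "\<lambda>x. measure (?K x) C"
  have K: "?K \<in> E \<rightarrow>\<^sub>M prob_algebra (path_field E {0..})"
    using measurable_return_prob_algebra measurable_chain_law[OF P] by (rule measurable_compose)
  have fE: "?f \<in> borel_measurable E"
    using measurable_prob_algebraD[OF K] measurable_measure_subprob_algebra[OF C] by (rule measurable_compose)
  have pK: "prob_space (?K x)" if "x \<in> space E" for x
    using chain_law_props(2)[OF P return_in_prob_algebra[OF that]] .
  have mix: "measure (chain_law E P \<rho>) C = (\<integral>x. ?f x \<partial>\<rho>)"
    and int: "integrable \<rho> ?f" and prob: "prob_space \<rho>" and sp: "space \<rho> = space E"
    if \<rho>: "\<rho> \<in> space (prob_algebra E)" for \<rho>
  proof -
    show prob: "prob_space \<rho>" and sp: "space \<rho> = space E"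
      using \<rho> by (auto simp: space_prob_algebra dest: sets_eq_imp_space_eq)
    interpret prob_space \<rho> by fact
    have s: "sets \<rho> = sets E" using \<rho> by (simp add: space_prob_algebra)
    have f: "?f \<in> borel_measurable \<rho>" using fE by (simp add: measurable_cong_sets[OF s refl])
    show "integrable \<rho> ?f"
      using f pK by (intro integrable_const_bound[where B=1]) (auto simp: sp prob_space.prob_le_1)
    have "chain_law E P \<rho> = \<rho> \<bind> ?K"
      using chain_law_bind[OF P \<rho> measurable_return_prob_algebra] by (simp add: bind_return''[OF s])
    then have "emeasure (chain_law E P \<rho>) C = (\<integral>\<^sup>+x. emeasure (?K x) C \<partial>\<rho>)"
      using emeasure_bind_prob_algebra[OF \<rho> K C] by simp
    also have "\<dots> = (\<integral>\<^sup>+x. ennreal (?f x) \<partial>\<rho>)"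
      using pK by (intro nn_integral_cong) (simp add: sp finite_measure.emeasure_eq_measure prob_space.finite_measure)
    finally show "measure (chain_law E P \<rho>) C = (\<integral>x. ?f x \<partial>\<rho>)"
      using f by (simp add: measure_def integral_eq_nn_integral)
  qed
  have "measure (chain_law E P \<mu>) C - c \<le> ?f x'" if x': "x' \<in> space E" for x'
  proof -
    have "(\<integral>x. ?f x \<partial>\<mu>) \<le> c + ?f x'"
      using osc[OF _ x'] by (intro prob_space.integral_le_const[OF prob[OF \<mu>] int[OF \<mu>]] AE_I2)
        (simp add: sp[OF \<mu>] algebra_simps)
    then show ?thesis by (simp add: mix[OF \<mu>])
  qed
  then have "measure (chain_law E P \<mu>) C - c \<le> (\<integral>x. ?f x \<partial>\<nu>)"
    by (intro prob_space.integral_ge_const[OF prob[OF \<nu>] int[OF \<nu>]] AE_I2) (simp add: sp[OF \<nu>])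
  then show ?thesis by (simp add: mix[OF \<nu>])
qed

section \<open>A zero-one law from a uniform bound\<close>

text \<open>
  Events from time \<open>n\<close> on, seen conditionally on a past event \<open>B\<close>, have the probability of the
  event shifted back by \<open>n\<close> under a chain started from another initial law, namely the conditional
  law of the state at time \<open>n\<close>.
\<close>
lemma conditional_future_law:
  assumes P: "P \<in> E \<rightarrow>\<^sub>M prob_algebra E" and Q: "markov_law E P Q"
    and n: "0 \<le> n" and B: "B \<in> sets (path_field E {0..n})" and pos: "measure Q B \<noteq> 0"
  shows "\<exists>\<rho>\<in>space (prob_algebra E). \<forall>A\<in>sets (path_field E {n..}).
    measure Q (B \<inter> A) = measure Q B *
      measure (chain_law E P \<rho>) (path_shift (- n) -` A \<inter> space (path_field E {0..}))"
proof (intro bexI ballI)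
  interpret prob_space Q using Q by (rule markov_lawD)
  have sQ: "sets Q = sets (path_field E {0..})" and spQ: "space Q = space (path_field E {0..})"
    using Q by (rule markov_lawD)+
  let ?R = "distr (uniform_measure Q B) (path_field E {0..}) (path_shift n)"
  let ?\<rho> = "distr ?R E (\<lambda>\<omega>. \<omega> 0)"
  have pos': "emeasure Q B \<noteq> 0" using pos by (simp add: emeasure_eq_measure)
  have R: "markov_law E P ?R" using markov_law_conditional_shift[OF P Q n B pos'] .
  have X: "(\<lambda>\<omega>. \<omega> 0) \<in> ?R \<rightarrow>\<^sub>M E" by (simp add: component_path_field)
  show \<rho>: "?\<rho> \<in> space (prob_algebra E)"
    using prob_space.prob_space_distr[OF markov_lawD(1)[OF R] X] by (simp add: space_prob_algebra)
  have chain: "chain_law E P ?\<rho> = ?R"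
    using is_chain_law_unique[OF P is_chain_law_chain_law[OF P \<rho>]] R
    by (simp add: is_chain_law_iff_markov_law[OF P])
  fix A assume A: "A \<in> sets (path_field E {n..})"
  let ?C = "path_shift (- n) -` A \<inter> space (path_field E {0..})"
  have C: "?C \<in> sets (path_field E {0..})"
    using A by (intro measurable_sets[OF measurable_path_shift]) auto
  have shift: "path_shift n \<in> uniform_measure Q B \<rightarrow>\<^sub>M path_field E {0..}"
    using measurable_path_shift[of "{0..}" n "{0..}" E] n
    by (subst measurable_cong_sets[where M'="path_field E {0..}" and N'="path_field E {0..}"]) (auto simp: sQ)
  have AQ: "A \<in> sets Q" and BQ: "B \<in> sets Q"
    using A B n sets_path_field_mono[of "{n..}" "{0..}" E] sets_path_field_mono[of "{0..n}" "{0..}" E]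
    by (auto simp: sQ)
  \<comment> \<open>Shifting back and forth is the identity, so the conditional probability of \<open>A\<close> itself appears.\<close>
  have shift_back: "path_shift n -` ?C \<inter> space Q = A"
    using sets.sets_into_space[OF AQ] by (auto simp: path_shift_def spQ space_path_field_eq)
  have "measure ?R ?C = measure (uniform_measure Q B) A"
    unfolding measure_distr[OF shift C] space_uniform_measure shift_back ..
  also have "\<dots> = measure Q (B \<inter> A) / measure Q B"
    using AQ BQ pos' by (intro measure_uniform_measure) auto
  finally show "measure Q (B \<inter> A) = measure Q B * measure (chain_law E P ?\<rho>) ?C"
    unfolding chain using pos by simp
qed

lemma subalgebra_path_field_sub:
  assumes "subalgebra E E0"
  shows "subalgebra (path_field E I) (path_field E0 I)"
proof -
  have "space E0 = space E" "sets E0 \<subseteq> sets E" using assms by (auto simp: subalgebra_def)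
  then have sp: "space (\<Pi>\<^sub>M k\<in>(UNIV :: int set). E0) = space (\<Pi>\<^sub>M k\<in>(UNIV :: int set). E)"
    and le: "sets E0 \<subseteq> sets E" by (simp_all add: space_PiM)
  show ?thesis
    unfolding subalgebra_def sets_path_field space_path_field sp
    by (intro conjI refl sigma_sets_mono' UN_mono order_refl Collect_mono) (use le in auto)
qed

lemma path_tail_sub: "path_tail G \<subseteq> sets (path_field G {int n..})"
  by (auto simp: path_tail_def)

text \<open>
  Conditioning on \<open>B\<close> and on its complement gives two initial laws at time \<open>n\<close>, so the two conditional
  probabilities of the tail event \<open>A\<close> differ by at most \<open>c\<close>. The covariance of \<open>A\<close> and \<open>B\<close> is this
  difference times the variance of \<open>B\<close>.
\<close>
lemma tail_covariance_bound:
  assumes P: "P \<in> E \<rightarrow>\<^sub>M prob_algebra E" and sub: "subalgebra E E0"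
    and osc: "\<And>C x x'. C \<in> path_tail E0 \<Longrightarrow> x \<in> space E \<Longrightarrow> x' \<in> space E \<Longrightarrow>
      measure (chain_law E P (return E x)) C - measure (chain_law E P (return E x')) C \<le> c"
    and A: "A \<in> path_tail E0" and Q: "markov_law E P Q"
    and B: "B \<in> sets (path_field E {0..int n})"
  shows "measure Q (B \<inter> A) - measure Q A * measure Q B \<le> c * (measure Q B * (1 - measure Q B))"
proof -
  interpret prob_space Q using Q by (rule markov_lawD)
  have sQ: "sets Q = sets (path_field E {0..})" using Q by (rule markov_lawD)
  let ?B' = "space Q - B"
  let ?C = "path_shift (- int n) -` A \<inter> space (path_field E {0..})"
  have tail: "C \<in> sets (path_field E {int k..})" if "C \<in> path_tail E0" for C k
    using that path_tail_sub[of E0 k] subalgebra_path_field_sub[OF sub, of "{int k..}"]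
    by (auto simp: subalgebra_def)
  have AQ: "A \<in> sets Q" using tail[OF A, of 0] by (simp add: sQ)
  have BQ: "B \<in> sets Q" using B sets_path_field_mono[of "{0..int n}" "{0..}" E] by (auto simp: sQ)
  have B': "?B' \<in> sets (path_field E {0..int n})"
    using sets.compl_sets[OF B] markov_lawD(3)[OF Q] by (simp add: space_path_field)
  have q': "prob ?B' = 1 - prob B" using BQ by (rule prob_compl)
  have "?B' \<inter> A = A - B" using sets.sets_into_space[OF AQ] by auto
  then have a': "prob (?B' \<inter> A) = prob A - prob (B \<inter> A)"
    using AQ BQ by (simp add: finite_measure_Diff' Int_commute)
  show ?thesis
  \<comment> \<open>One of the two conditional laws does not exist if \<open>B\<close> is trivial, but then both sides vanish.\<close>
  proof (cases "prob B = 0 \<or> prob ?B' = 0")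
    case True
    moreover have "prob (B \<inter> A) \<le> prob B" "prob (?B' \<inter> A) \<le> prob ?B'"
      using AQ BQ by (auto intro!: finite_measure_mono)
    ultimately have "prob (B \<inter> A) - prob A * prob B = 0" "prob B * (1 - prob B) = 0"
      using a' q' measure_nonneg[of Q "B \<inter> A"] measure_nonneg[of Q "?B' \<inter> A"]
      by (auto simp del: measure_nonneg)
    then show ?thesis by (metis mult_zero_right order_refl)
  next
    case False
    have C: "?C \<in> path_tail E0"
      using path_shift_in_path_tail[OF A, of "- int n" "{0..}"] sub
      by (simp add: space_path_field_eq subalgebra_def)
    obtain \<mu> where \<mu>: "\<mu> \<in> space (prob_algebra E)"
      and u: "prob (B \<inter> A) = prob B * measure (chain_law E P \<mu>) ?C"
      using conditional_future_law[OF P Q _ B] False tail[OF A] by auto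
    obtain \<nu> where \<nu>: "\<nu> \<in> space (prob_algebra E)"
      and v: "prob (?B' \<inter> A) = prob ?B' * measure (chain_law E P \<nu>) ?C"
      using conditional_future_law[OF P Q _ B'] False tail[OF A] by auto
    define u where "u = measure (chain_law E P \<mu>) ?C"
    define v where "v = measure (chain_law E P \<nu>) ?C"
    have uv: "u - v \<le> c"
      unfolding u_def v_def using tail[OF C, of 0] by (intro chain_law_oscillation[OF P _ \<mu> \<nu>] osc[OF C]) auto
    have "prob (B \<inter> A) - prob A * prob B
        = prob (B \<inter> A) * (1 - prob B) - prob B * prob (?B' \<inter> A)"
      unfolding a' by (simp add: algebra_simps)
    also have "\<dots> = (prob B * (1 - prob B)) * (u - v)"
      unfolding u v q' u_def v_def by (simp add: algebra_simps)
    also have "\<dots> \<le> (prob B * (1 - prob B)) * c"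
      using uv by (intro mult_left_mono mult_nonneg_nonneg) auto
    finally show ?thesis by (simp only: mult.commute[of c])
  qed
qed

text \<open>
  Let \<open>B\<close> approximate \<open>A\<close> in the covariance bound. In the limit the covariance becomes the variance of
  \<open>A\<close>, so \<open>p * (1 - p) \<le> c * (p * (1 - p))\<close> for the probability \<open>p\<close> of \<open>A\<close>, and \<open>c < 1\<close> leaves only
  \<open>p = 0\<close> and \<open>p = 1\<close>.
\<close>
lemma tail_trivial_of_uniform_bound:
  assumes P: "P \<in> E \<rightarrow>\<^sub>M prob_algebra E" and sub: "subalgebra E E0"
    and osc: "\<And>C x x'. C \<in> path_tail E0 \<Longrightarrow> x \<in> space E \<Longrightarrow> x' \<in> space E \<Longrightarrow>
      measure (chain_law E P (return E x)) C - measure (chain_law E P (return E x')) C \<le> c"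
    and c: "0 \<le> c" "c < 1" and A: "A \<in> path_tail E0" and Q: "markov_law E P Q"
  shows "measure Q A \<in> {0, 1}"
proof -
  interpret prob_space Q using Q by (rule markov_lawD)
  have sQ: "sets Q = sets (path_field E {0..})" and spQ: "space Q = space (path_field E {0..})"
    using Q by (rule markov_lawD)+
  have AQ: "A \<in> sets Q"
    using A path_tail_sub[of E0 0] subalgebra_path_field_sub[OF sub, of "{0..}"]
    by (auto simp: subalgebra_def sQ)
  let ?p = "prob A"
  have "(1 - c) * (?p * (1 - ?p)) \<le> 3 * e" if e: "0 < e" for e
  proof -
    have "\<exists>B\<in>(\<Union>n. sets (path_field E {0..int n})). prob (A - B) + prob (B - A) < e"
      using algebra_finite_horizon sets_path_field_finite_horizon AQ e
      by (intro approximation_by_generating_algebra finite_measure_axioms) (auto simp: sQ spQ)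
    then obtain n B where B: "B \<in> sets (path_field E {0..int n})"
      and Be: "prob (A - B) + prob (B - A) < e" by blast
    have BQ: "B \<in> sets Q" using B sets_path_field_mono[of "{0..int n}" "{0..}" E] by (auto simp: sQ)
    let ?q = "prob B" and ?a = "prob (B \<inter> A)"
    have "?p = ?a + prob (A - B)" "?q = ?a + prob (B - A)"
      using AQ BQ by (auto simp: finite_measure_Diff' Int_commute)
    then have a: "?p - e \<le> ?a" and q: "\<bar>?q - ?p\<bar> \<le> e"
      using Be measure_nonneg[of Q "A - B"] measure_nonneg[of Q "B - A"] by linarith+
    have cov: "?a - ?p * ?q \<le> c * (?q * (1 - ?q))"
      by (rule tail_covariance_bound[OF P sub osc A Q B])
    have "?q * (1 - ?q) - ?p * (1 - ?p) = (?q - ?p) * (1 - ?p - ?q)" by (simp add: algebra_simps)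
    also have "\<dots> \<le> \<bar>?q - ?p\<bar> * \<bar>1 - ?p - ?q\<bar>" by (metis abs_ge_self abs_mult)
    also have "\<bar>1 - ?p - ?q\<bar> \<le> 1"
      using prob_le_1[of A] prob_le_1[of B] measure_nonneg[of Q A] measure_nonneg[of Q B] by linarith
    then have "\<bar>?q - ?p\<bar> * \<bar>1 - ?p - ?q\<bar> \<le> e * 1" using q e by (intro mult_mono) auto
    finally have "?q * (1 - ?q) \<le> ?p * (1 - ?p) + e" by simp
    then have "c * (?q * (1 - ?q)) \<le> c * (?p * (1 - ?p) + e)" using c by (intro mult_left_mono)
    moreover have "c * e \<le> e" using c e by simp
    moreover have "?p * (?q - ?p) \<le> e"
      using mult_mono[of ?p 1 "\<bar>?q - ?p\<bar>" e] q prob_le_1[of A]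
        mult_left_mono[OF abs_ge_self[of "?q - ?p"], of ?p] by simp
    ultimately show ?thesis using cov a by (simp add: algebra_simps)
  qed
  \<comment> \<open>Were the left-hand side positive, a quarter of it as \<open>e\<close> would bound it by three quarters of itself.\<close>
  from this[of "(1 - c) * (?p * (1 - ?p)) / 4"] have "\<not> 0 < (1 - c) * (?p * (1 - ?p))" by auto
  then have "?p * (1 - ?p) \<le> 0" using c by (metis diff_gt_0_iff_gt mult_pos_pos not_less)
  then show ?thesis using prob_le_1[of A] measure_nonneg[of Q A] by (auto simp: mult_le_0_iff)
qed

section \<open>The equivalence\<close>

text \<open>
  The chain started from the mean of two initial laws gives \<open>A\<close> the mean of two numbers in \<open>{0, 1}\<close>,
  which is again in \<open>{0, 1}\<close> only if the two numbers agree.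
\<close>
lemma tail_trivial_imp_equal:
  assumes P: "P \<in> E \<rightarrow>\<^sub>M prob_algebra E" and A: "A \<in> sets (path_field E {0..})"
    and triv: "\<And>\<mu>. \<mu> \<in> space (prob_algebra E) \<Longrightarrow> measure (chain_law E P \<mu>) A \<in> {0, 1}"
    and \<mu>: "\<mu> \<in> space (prob_algebra E)" and \<nu>: "\<nu> \<in> space (prob_algebra E)"
  shows "measure (chain_law E P \<mu>) A = measure (chain_law E P \<nu>) A"
proof -
  let ?M = "measure_pmf (bernoulli_pmf (1 / 2))"
  let ?m = "\<lambda>b. if b then \<mu> else \<nu>"
  have M: "?M \<in> space (prob_algebra (count_space UNIV))"
    by (simp add: space_prob_algebra measure_pmf.prob_space_axioms)
  have m: "?m \<in> count_space UNIV \<rightarrow>\<^sub>M prob_algebra E" using \<mu> \<nu> by simp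
  have fin: "emeasure (chain_law E P \<rho>) A = ennreal (measure (chain_law E P \<rho>) A)"
    if "\<rho> \<in> space (prob_algebra E)" for \<rho>
    using chain_law_props(2)[OF P that] by (simp add: finite_measure.emeasure_eq_measure prob_space.finite_measure)
  have mix: "?M \<bind> ?m \<in> space (prob_algebra E)"
    using prob_space_bind'[OF M m] sets_bind'[OF M m] by (simp add: space_prob_algebra)
  have "emeasure (chain_law E P (?M \<bind> ?m)) A = (\<integral>\<^sup>+b. emeasure (chain_law E P (?m b)) A \<partial>?M)"
    unfolding chain_law_bind[OF P M m]
    by (intro emeasure_bind_prob_algebra[OF M _ A] measurable_compose[OF m measurable_chain_law[OF P]])
  also have "\<dots> = ennreal (measure (chain_law E P \<mu>) A) * ennreal (1 / 2)
      + ennreal (measure (chain_law E P \<nu>) A) * ennreal (1 - 1 / 2)"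
    by (subst nn_integral_bernoulli_pmf) (simp_all only: fin \<mu> \<nu> if_True if_False, simp_all)
  also have "\<dots> = ennreal (measure (chain_law E P \<mu>) A * (1 / 2) + measure (chain_law E P \<nu>) A * (1 - 1 / 2))"
    by (subst ennreal_plus) (simp_all only: ennreal_mult' measure_nonneg, simp_all)
  finally have "measure (chain_law E P (?M \<bind> ?m)) A = (measure (chain_law E P \<mu>) A + measure (chain_law E P \<nu>) A) / 2"
    by (simp add: fin[OF mix] add_divide_distrib flip: ennreal_plus)
  with triv[OF mix] triv[OF \<mu>] triv[OF \<nu>] show ?thesis by auto
qed

theorem theorem2p1:
  fixes E E0 :: "'a measure" and P :: "'a \<Rightarrow> 'a measure"
  assumes "P \<in> E \<rightarrow>\<^sub>M prob_algebra E"
    and "subalgebra E E0"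
  shows "((\<forall>\<mu>\<in>space (prob_algebra E). \<forall>\<nu>\<in>space (prob_algebra E).
            (\<lambda>n. tv_dist (path_field E0 {int n..}) (chain_law E P \<mu>) (chain_law E P \<nu>)) \<longlonglongrightarrow> 0)
          \<longleftrightarrow>
          (\<forall>A\<in>path_tail E0. \<forall>\<mu>\<in>space (prob_algebra E). measure (chain_law E P \<mu>) A \<in> {0, 1}))
       \<and>
         ((\<forall>A\<in>path_tail E0. \<forall>\<mu>\<in>space (prob_algebra E). measure (chain_law E P \<mu>) A \<in> {0, 1})
          \<longleftrightarrow>
          (\<exists>\<alpha>>0. \<forall>x\<in>space E. \<forall>x'\<in>space E. \<exists>n::nat.
            tv_dist (path_field E0 {int n..})
              (chain_law E P (return E x)) (chain_law E P (return E x')) \<le> 2 - \<alpha>))"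
    (is "(?erg \<longleftrightarrow> ?triv) \<and> (?triv \<longleftrightarrow> ?irr)")
proof -
  note P = assms(1) and sub = assms(2)
  have fin: "finite_measure (chain_law E P \<mu>)" if "\<mu> \<in> space (prob_algebra E)" for \<mu>
    using chain_law_props(2)[OF P that] by (rule prob_space.finite_measure)
  have subQ: "subalgebra (chain_law E P \<mu>) (path_field E0 {int n..})"
    if "\<mu> \<in> space (prob_algebra E)" for \<mu> n
    using subalgebra_path_field_sub[OF sub, of "{int n..}"] subalgebra_path_field[of "{int n..}" "{0..}" E]
      chain_law_props(3,4)[OF P that]
    by (auto simp: subalgebra_def)
  have "?irr" if erg: ?erg
  proof (rule exI[of _ 1], rule conjI[OF zero_less_one], rule ballI, rule ballI)
    fix x x' assume x: "x \<in> space E" "x' \<in> space E"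
    have "(\<lambda>n. tv_dist (path_field E0 {int n..})
        (chain_law E P (return E x)) (chain_law E P (return E x'))) \<longlonglongrightarrow> 0"
      by (rule erg[rule_format, OF return_in_prob_algebra[OF x(1)] return_in_prob_algebra[OF x(2)]])
    then obtain n where "\<bar>tv_dist (path_field E0 {int n..})
        (chain_law E P (return E x)) (chain_law E P (return E x'))\<bar> < 1"
      by (metis LIMSEQ_D diff_zero order_refl real_norm_def zero_less_one)
    then show "\<exists>n. tv_dist (path_field E0 {int n..})
        (chain_law E P (return E x)) (chain_law E P (return E x')) \<le> 2 - 1"
      by (intro exI[of _ n]) simp
  qed
  moreover have "?triv" if irr: ?irr
  proof (intro ballI)
    fix A \<mu> assume A: "A \<in> path_tail E0" and \<mu>: "\<mu> \<in> space (prob_algebra E)"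
    from irr obtain \<alpha> where \<alpha>: "0 < \<alpha>" and le: "\<forall>x\<in>space E. \<forall>x'\<in>space E.
      \<exists>n. tv_dist (path_field E0 {int n..}) (chain_law E P (return E x)) (chain_law E P (return E x')) \<le> 2 - \<alpha>"
      by (elim exE conjE)
    \<comment> \<open>A tail event lies in every future \<open>\<sigma>\<close>-field, so the time \<open>n\<close>, which depends on the two points, disappears.\<close>
    have osc: "measure (chain_law E P (return E x)) C - measure (chain_law E P (return E x')) C \<le> 1 - \<alpha> / 2"
      if C: "C \<in> path_tail E0" and x: "x \<in> space E" "x' \<in> space E" for C x x'
    proof -
      obtain n where n: "tv_dist (path_field E0 {int n..})
          (chain_law E P (return E x)) (chain_law E P (return E x')) \<le> 2 - \<alpha>"
        using le[rule_format, OF x] by (elim exE)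
      have "C \<in> sets (path_field E0 {int n..})" using C path_tail_sub by blast
      from abs_le_D1[OF abs_diff_le_tv_dist[OF fin[OF return_in_prob_algebra[OF x(1)]]
          fin[OF return_in_prob_algebra[OF x(2)]] this]] n
      show ?thesis by linarith
    qed
    have "space \<mu> \<noteq> {}" "space \<mu> = space E"
      using \<mu> by (auto simp: space_prob_algebra prob_space.not_empty dest: sets_eq_imp_space_eq)
    then obtain x where "x \<in> space E" by blast
    \<comment> \<open>Comparing a point with itself shows that the bound is nonnegative.\<close>
    from osc[OF A this this] have "0 \<le> 1 - \<alpha> / 2" by simp
    then show "measure (chain_law E P \<mu>) A \<in> {0, 1}"
      using \<alpha> by (intro tail_trivial_of_uniform_bound[OF P sub osc _ _ A chain_law_props(1)[OF P \<mu>]]) auto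
  qed
  moreover have "?erg" if triv: ?triv
  proof (intro ballI)
    fix \<mu> \<nu> assume \<mu>: "\<mu> \<in> space (prob_algebra E)" and \<nu>: "\<nu> \<in> space (prob_algebra E)"
    show "(\<lambda>n. tv_dist (path_field E0 {int n..}) (chain_law E P \<mu>) (chain_law E P \<nu>)) \<longlonglongrightarrow> 0"
    proof (rule tv_dist_tendsto_0[OF fin[OF \<mu>] fin[OF \<nu>] _ subQ[OF \<mu>]])
      show "sets (chain_law E P \<nu>) = sets (chain_law E P \<mu>)"
        using chain_law_props(3)[OF P \<mu>] chain_law_props(3)[OF P \<nu>] by simp
      show "decseq (\<lambda>n. sets (path_field E0 {int n..}))"
        unfolding decseq_def by (intro allI impI sets_path_field_mono) auto
      fix A assume "A \<in> (\<Inter>n. sets (path_field E0 {int n..}))"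
      then have A: "A \<in> path_tail E0" by (simp add: path_tail_def)
      then have "A \<in> sets (path_field E {0..})"
        using path_tail_sub[of E0 0] subalgebra_path_field_sub[OF sub, of "{0..}"] by (auto simp: subalgebra_def)
      then show "measure (chain_law E P \<mu>) A = measure (chain_law E P \<nu>) A"
        by (rule tail_trivial_imp_equal[OF P _ triv[rule_format, OF A] \<mu> \<nu>])
    qed
  qed
  ultimately show ?thesis by blast
qed

end
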